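(* Let $\alpha\in(0,1)$, $n\in\mathbb N=\{1,2,\dots\}$, $0<a<b$, and $x\in C^{n+1}[a,b]$. Then for every $t\in\,]a,b[$, $$ \begin{aligned} {_a\mathcal{D}_t^\alpha} x(t)={}&\frac{1}{\Gamma(1-\alpha)}\left(\ln\frac{t}{a}\right)^{-\alpha}x(t)+\sum_{i=1}^{n}A_i(\alpha)\left(\ln\frac{t}{a}\right)^{i-\alpha} x_{i,0}(t)\\ &+\sum_{p=n+1}^\infty \left[B(\alpha,p)\left(\ln\frac{t}{a}\right)^{n-\alpha-p}V_p(t)+\frac{\Gamma(p+\alpha-n)}{\Gamma(1-\alpha)\Gamma(\alpha)(p-n)!}\left(\ln\frac{t}{a}\right)^{-\alpha}x(t)\right] \end{aligned} $$ (the series, including those defining $A_i(\alpha)$, being convergent), where $$ A_i(\alpha)=\frac{1}{\Gamma(i+1-\alpha)}\left[1+\sum_{p=n-i+1}^\infty\frac{\Gamma(p+\alpha-n)}{\Gamma(\alpha-i)(p-n+i)!}\right],\quad i\in\{1,\ldots,n\}, $$ $$ B(\alpha,p)=\frac{\Gamma(p+\alpha-n)}{\Gamma(-\alpha)\Gamma(1+\alpha)(p-n)!},\qquad V_p(t)=\int_a^t (p-n)\left(\ln\frac{\tau}{a}\right)^{p-n-1}\frac{x(\tau)}{\tau}\,d\tau,\quad p\in\{n+1,n+2,\ldots\}. $$ Moreover, for every integer $N\ge n+1$, consider the approximation $$ {_a\mathcal{D}_t^\alpha} x(t)\approx \sum_{i=0}^{n}A_i(\alpha,N)\left(\ln\frac{t}{a}\right)^{i-\alpha}x_{i,0}(t)+\sum_{p=n+1}^N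 B(\alpha,p)\left(\ln\frac{t}{a}\right)^{n-\alpha-p}V_p(t) $$ with $$ A_i(\alpha,N)=\frac{1}{\Gamma(i+1-\alpha)}\left[1+\sum_{p=n-i+1}^N\frac{\Gamma(p+\alpha-n)}{\Gamma(\alpha-i)(p-n+i)!}\right],\quad i\in\{0,\ldots,n\}. $$ Then the error $E_{tr}(t)$ (the left-hand side minus the right-hand side of the approximation) satisfies, for every $t\in\,]a,b[$, $$ \left| E_{tr}(t)\right|\leq L_n(t)\,\frac{e^{(n-\alpha)^2+n-\alpha}}{\Gamma(n+1-\alpha)(n-\alpha)N^{n-\alpha}}\left(\ln\frac{t}{a}\right)^{n-\alpha}(t-a),\qquad L_n(t)=\max_{\tau\in[a,t]}|x_{n,1}(\tau)|. $$
   Context: For $0<a<b$ and $\alpha\in(0,1)$, the left Hadamard fractional derivative of order $\alpha$ of $x:[a,b]\to\mathbb R$ is $$ {_a\mathcal{D}_t^\alpha} x(t)=t\frac{d}{dt}\,\frac{1}{\Gamma(1-\alpha)}\int_a^t \left(\ln\frac{t}{\tau}\right)^{-\alpha}\frac{x(\tau)}{\tau}\,d\tau,\quad t\in\,]a,b[. $$ For absolutely continuous $x$ it equals $$ \frac{x(a)}{\Gamma(1-\alpha)}\left(\ln\frac{t}{a}\right)^{-\alpha}+\frac{1}{\Gamma(1-\alpha)}\int_a^t \left(\ln\frac{t}{\tau}\right)^{-\alpha}\dot{x}(\tau)\,d\tau . $$ The functions $x_{k,0}$ and $x_{k,1}$ are defined recursively for $k\ge 0$ by $x_{0,0}(t)=x(t)$,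 $x_{k+1,0}(t)=t\frac{d}{dt}x_{k,0}(t)$, and $x_{0,1}(t)=\dot x(t)$, $x_{k+1,1}(t)=\frac{d}{dt}\bigl(t\,x_{k,1}(t)\bigr)$. *)

theory Defs
  imports "HOL-Analysis.Analysis"
begin

text \<open>Derivatives of functions on \<open>[a,b]\<close> are taken within \<open>[a,b]\<close>, hence one-sided at the
  endpoints; values outside \<open>[a,b]\<close> are irrelevant.\<close>

definition deriv_Icc :: "real \<Rightarrow> real \<Rightarrow> (real \<Rightarrow> real) \<Rightarrow> real \<Rightarrow> real" where
  "deriv_Icc a b f t = vector_derivative f (at t within {a..b})"

primrec C_Icc :: "nat \<Rightarrow> real \<Rightarrow> real \<Rightarrow> (real \<Rightarrow> real) \<Rightarrow> bool" where
  "C_Icc 0 a b f \<longleftrightarrow> continuous_on {a..b} f"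
| "C_Icc (Suc k) a b f \<longleftrightarrow> f differentiable_on {a..b} \<and> C_Icc k a b (deriv_Icc a b f)"

definition hadamard_integral :: "real \<Rightarrow> real \<Rightarrow> (real \<Rightarrow> real) \<Rightarrow> real \<Rightarrow> real" where
  "hadamard_integral a \<alpha> x t =
     1 / Gamma (1 - \<alpha>) * integral {a..t} (\<lambda>\<tau>. ln (t / \<tau>) powr (- \<alpha>) * (x \<tau> / \<tau>))"

definition hadamard_deriv :: "real \<Rightarrow> real \<Rightarrow> (real \<Rightarrow> real) \<Rightarrow> real \<Rightarrow> real" where
  "hadamard_deriv a \<alpha> x t = t * deriv (hadamard_integral a \<alpha> x) t"

primrec x0 :: "real \<Rightarrow> real \<Rightarrow> (real \<Rightarrow> real) \<Rightarrow> nat \<Rightarrow> real \<Rightarrow> real" where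
  "x0 a b x 0 = x"
| "x0 a b x (Suc k) = (\<lambda>t. t * deriv_Icc a b (x0 a b x k) t)"

primrec x1 :: "real \<Rightarrow> real \<Rightarrow> (real \<Rightarrow> real) \<Rightarrow> nat \<Rightarrow> real \<Rightarrow> real" where
  "x1 a b x 0 = deriv_Icc a b x"
| "x1 a b x (Suc k) = deriv_Icc a b (\<lambda>t. t * x1 a b x k t)"

text \<open>The factorial argument is written \<open>p + i - n\<close> rather than \<open>p - n + i\<close>, since \<open>p < n\<close> may occur
  and subtraction on \<open>nat\<close> truncates; \<open>p \<ge> n - i + 1\<close> and \<open>i \<le> n\<close> wherever it is used.\<close>

definition A_summand :: "real \<Rightarrow> nat \<Rightarrow> nat \<Rightarrow> nat \<Rightarrow> real" where
  "A_summand \<alpha> n i p =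
     Gamma (real p + \<alpha> - real n) / (Gamma (\<alpha> - real i) * fact (p + i - n))"

text \<open>An infinite series over \<open>p \<ge> m\<close> is written as a series over \<open>k \<ge> 0\<close> with \<open>p = m + k\<close>.\<close>

definition A_coeff :: "real \<Rightarrow> nat \<Rightarrow> nat \<Rightarrow> real" where
  "A_coeff \<alpha> n i =
     1 / Gamma (real i + 1 - \<alpha>) * (1 + (\<Sum>k. A_summand \<alpha> n i (n - i + 1 + k)))"

definition A_coeff_trunc :: "real \<Rightarrow> nat \<Rightarrow> nat \<Rightarrow> nat \<Rightarrow> real" where
  "A_coeff_trunc \<alpha> n N i =
     1 / Gamma (real i + 1 - \<alpha>) * (1 + (\<Sum>p = n - i + 1..N. A_summand \<alpha> n i p))"

definition B_coeff :: "real \<Rightarrow> nat \<Rightarrow> nat \<Rightarrow> real" where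
  "B_coeff \<alpha> n p =
     Gamma (real p + \<alpha> - real n) / (Gamma (- \<alpha>) * Gamma (1 + \<alpha>) * fact (p - n))"

definition V :: "real \<Rightarrow> (real \<Rightarrow> real) \<Rightarrow> nat \<Rightarrow> nat \<Rightarrow> real \<Rightarrow> real" where
  "V a x n p t =
     integral {a..t} (\<lambda>\<tau>. real (p - n) * ln (\<tau> / a) ^ (p - n - 1) * (x \<tau> / \<tau>))"

definition series_term :: "real \<Rightarrow> real \<Rightarrow> (real \<Rightarrow> real) \<Rightarrow> nat \<Rightarrow> real \<Rightarrow> nat \<Rightarrow> real" where
  "series_term a \<alpha> x n t p =
     B_coeff \<alpha> n p * ln (t / a) powr (real n - \<alpha> - real p) * V a x n p t
     + Gamma (real p + \<alpha> - real n) / (Gamma (1 - \<alpha>) * Gamma \<alpha> * fact (p - n))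
         * ln (t / a) powr (- \<alpha>) * x t"

definition hadamard_approx ::
  "real \<Rightarrow> real \<Rightarrow> real \<Rightarrow> (real \<Rightarrow> real) \<Rightarrow> nat \<Rightarrow> nat \<Rightarrow> real \<Rightarrow> real" where
  "hadamard_approx a b \<alpha> x n N t =
     (\<Sum>i = 0..n. A_coeff_trunc \<alpha> n N i * ln (t / a) powr (real i - \<alpha>) * x0 a b x i t)
     + (\<Sum>p = n + 1..N. B_coeff \<alpha> n p * ln (t / a) powr (real n - \<alpha> - real p) * V a x n p t)"

definition E_tr ::
  "real \<Rightarrow> real \<Rightarrow> real \<Rightarrow> (real \<Rightarrow> real) \<Rightarrow> nat \<Rightarrow> nat \<Rightarrow> real \<Rightarrow> real" where
  "E_tr a b \<alpha> x n N t = hadamard_deriv a \<alpha> x t - hadamard_approx a b \<alpha> x n N t"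

text \<open>\<open>GREATEST\<close> is the maximum of a possibly infinite set (\<open>Max\<close> is only meaningful for finite sets).\<close>

definition L :: "real \<Rightarrow> real \<Rightarrow> (real \<Rightarrow> real) \<Rightarrow> nat \<Rightarrow> real \<Rightarrow> real" where
  "L a b x n t = (GREATEST m. m \<in> (\<lambda>\<tau>. \<bar>x1 a b x n \<tau>\<bar>) ` {a..t})"

end

theory Submission
  imports Defs
begin

text \<open>
  With \<open>l = ln (t / a)\<close>, repeated integration by parts of the Hadamard integral gives the Taylor formula
  \<open>D x t = (\<Sum>i\<le>n. x\<^sub>i(a) l powr (i - \<alpha>) / \<Gamma>(i + 1 - \<alpha>)) + 1 / \<Gamma>(n + 1 - \<alpha>) \<integral> ln (t / \<tau>) powr (n - \<alpha>) x\<^sub>n\<^sub>+\<^sub>1(\<tau>) / \<tau> d\<tau>\<close>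
  with \<open>x\<^sub>i = x\<^sub>i\<^sub>,\<^sub>0\<close>. Writing \<open>ln (t / \<tau>) = l (1 - u)\<close> with \<open>u = ln (\<tau> / a) / l\<close>, one expands
  \<open>(1 - u) powr (n - \<alpha>)\<close> in its binomial series. Truncating that series at \<open>N\<close> and integrating the
  resulting polynomial kernel back by parts yields exactly the approximation, because the derivative of
  the partial sum for exponent \<open>\<beta> + 1\<close> is \<open>- (\<beta> + 1)\<close> times the one for \<open>\<beta>\<close>. So the error is the
  integral of the binomial remainder against \<open>x\<^sub>n\<^sub>,\<^sub>1\<close>; it is controlled by
  \<open>\<bar>c\<^sub>p\<bar> \<le> exp (\<beta>\<^sup>2 + \<beta>) / p powr (\<beta> + 1)\<close> for the binomial coefficients, and letting \<open>N\<close> tend to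
  infinity gives the series expansion.
\<close>

section \<open>Coefficients of the binomial series\<close>

text \<open>The coefficient of \<open>u ^ p\<close> in \<open>(1 - u) powr \<beta>\<close>, i.e. \<open>(- 1) ^ p * (\<beta> gchoose p)\<close>.\<close>

definition binom_coeff :: "real \<Rightarrow> nat \<Rightarrow> real" where
  "binom_coeff \<beta> p = pochhammer (- \<beta>) p / fact p"

lemma binom_coeff_0 [simp]: "binom_coeff \<beta> 0 = 1"
  by (simp add: binom_coeff_def)

lemma binom_coeff_Suc: "binom_coeff \<beta> (Suc p) = binom_coeff \<beta> p * (1 - (\<beta> + 1) / (real p + 1))"
  by (simp add: binom_coeff_def pochhammer_Suc field_simps)

text \<open>Coefficient form of d/du (1 - u)^(\<beta> + 1) = - (\<beta> + 1) (1 - u)^\<beta>. It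
  lets partial sums be differentiated termwise, lowering exponent and degree by one
  together.\<close>

lemma binom_coeff_Suc_shift:
  "(real p + 1) * binom_coeff (\<beta> + 1) (Suc p) = - (\<beta> + 1) * binom_coeff \<beta> p"
proof -
  have "pochhammer (- (\<beta> + 1)) (Suc p) = - (\<beta> + 1) * pochhammer (- \<beta>) p"
    by (subst pochhammer_rec) (simp add: algebra_simps)
  then show ?thesis
    unfolding binom_coeff_def by (simp only: fact_Suc of_nat_Suc) (simp add: divide_simps)
qed

lemma binom_coeff_Gamma:
  assumes "\<beta> \<notin> \<int>"
  shows "binom_coeff \<beta> p = Gamma (real p - \<beta>) / (Gamma (- \<beta>) * fact p)"
proof -
  have "- \<beta> \<notin> \<int>\<^sub>\<le>\<^sub>0"
    using assms nonpos_Ints_Int minus_in_Ints_iff by blast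
  from pochhammer_Gamma[OF this, of p] show ?thesis
    by (simp add: binom_coeff_def)
qed

lemma binom_coeff_sums:
  assumes "\<bar>u\<bar> < 1"
  shows "(\<lambda>p. binom_coeff \<beta> p * u ^ p) sums (1 - u) powr \<beta>"
proof -
  have "(\<lambda>p. (\<beta> gchoose p) * (- u) ^ p) sums (1 + - u) powr \<beta>"
    using assms by (intro gen_binomial_real) simp
  moreover have "(\<beta> gchoose p) * (- u) ^ p = binom_coeff \<beta> p * u ^ p" for p
  proof -
    have "(- u) ^ p = (- 1) ^ p * u ^ p"
      by (metis mult_minus1 power_mult_distrib)
    moreover have "(- 1) ^ p * (- 1) ^ p = (1::real)"
      by (simp flip: power_mult_distrib)
    ultimately show ?thesis
      by (simp add: binom_coeff_def gbinomial_pochhammer)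
  qed
  ultimately show ?thesis by simp
qed

section \<open>Decay of the binomial coefficients and the tail of the series\<close>

text \<open>The difference \<open>harm n - ln n\<close> decreases to Euler's constant, which exceeds
  19/33 and hence 1/2.\<close>

lemma harm_ge_ln_plus_half:
  assumes "n > 0"
  shows "ln (real n) + 1 / 2 \<le> harm n"
proof -
  obtain m where m: "n = Suc m" using assms by (cases n) auto
  have "(\<lambda>k. harm (Suc k) - ln (real (Suc k))) \<longlonglongrightarrow> (euler_mascheroni :: real)"
    using euler_mascheroni_LIMSEQ LIMSEQ_Suc by blast
  from decseq_ge[OF decseq_harm_diff_ln this, of m] show ?thesis
    using euler_mascheroni_gt_19_over_33 m by simp
qed

text \<open>Apply z \<le> exp (z - 1) to z = (1 - y)^2 and take square roots. Squaring first covers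
  y > 1 too, that is, the factors 1 - w / j with j < w.\<close>

lemma abs_one_minus_le_exp: "\<bar>1 - y\<bar> \<le> exp (y\<^sup>2 / 2 - y)" for y :: real
proof -
  have "\<bar>1 - y\<bar>\<^sup>2 \<le> exp ((1 - y)\<^sup>2 - 1)"
    using exp_ge_add_one_self[of "(1 - y)\<^sup>2 - 1"] by simp
  also have "(1 - y)\<^sup>2 - 1 = (y\<^sup>2 / 2 - y) + (y\<^sup>2 / 2 - y)"
    by (simp add: power2_eq_square algebra_simps)
  also have "exp \<dots> = (exp (y\<^sup>2 / 2 - y))\<^sup>2"
    by (simp only: exp_add power2_eq_square)
  finally show ?thesis by (rule power2_le_imp_le) simp
qed

text \<open>The coefficient is the product of the factors \<open>1 - w / j\<close>, \<open>1 \<le> j \<le> p\<close>. The first two are kept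
  apart, since \<open>abs_one_minus_le_exp\<close> is too lossy there; for the others \<open>2 / 5 - 1 / (p + 1 / 2)\<close>
  bounds the sum of \<open>1 / j\<^sup>2\<close> over \<open>3 \<le> j \<le> p\<close> by telescoping.\<close>

lemma abs_binom_coeff_le_aux:
  assumes "p \<ge> 2" and w: "w = \<beta> + 1"
  shows "\<bar>binom_coeff \<beta> p\<bar> \<le> \<bar>binom_coeff \<beta> 2\<bar>
    * exp (w\<^sup>2 / 2 * (2 / 5 - 1 / (real p + 1 / 2)) - w * (harm p - 3 / 2))"
  using assms(1)
proof (induction p rule: dec_induct)
  \<comment> \<open>Here the exponent vanishes: 1 / (2 + 1/2) = 2/5 and \<open>harm 2\<close> =
    3/2.\<close>
  case base
  then show ?case by (simp add: harm_def numeral_2_eq_2)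
next
  case (step p)
  let ?y = "w / (real p + 1)"
  \<comment> \<open>The right-hand side is 1 / ((p + 1)^2 - 1/4).\<close>
  have "1 / (real p + 1)\<^sup>2 \<le> 1 / (real p + 1 / 2) - 1 / (real p + 3 / 2)"
    by (simp add: divide_simps power2_eq_square) (simp add: algebra_simps)
  then have "w\<^sup>2 / 2 * (1 / (real p + 1)\<^sup>2) \<le> w\<^sup>2 / 2 * (1 / (real p + 1 / 2) - 1 / (real p + 3 / 2))"
    by (intro mult_left_mono) auto
  then have *: "?y\<^sup>2 / 2 - ?y \<le> w\<^sup>2 / 2 * (1 / (real p + 1 / 2) - 1 / (real p + 3 / 2)) - ?y"
    by (simp add: power_divide)
  have "\<bar>binom_coeff \<beta> (Suc p)\<bar> = \<bar>binom_coeff \<beta> p\<bar> * \<bar>1 - ?y\<bar>"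
    by (simp add: binom_coeff_Suc abs_mult w)
  also have "\<dots> \<le> (\<bar>binom_coeff \<beta> 2\<bar>
      * exp (w\<^sup>2 / 2 * (2 / 5 - 1 / (real p + 1 / 2)) - w * (harm p - 3 / 2)))
      * exp (w\<^sup>2 / 2 * (1 / (real p + 1 / 2) - 1 / (real p + 3 / 2)) - ?y)"
    using abs_one_minus_le_exp[of ?y] *
    by (intro mult_mono step.IH) (auto intro: order_trans)
  also have "\<dots> = \<bar>binom_coeff \<beta> 2\<bar>
    * exp (w\<^sup>2 / 2 * (2 / 5 - 1 / (real (Suc p) + 1 / 2)) - w * (harm (Suc p) - 3 / 2))"
    by (simp add: mult.assoc exp_add[symmetric] harm_Suc algebra_simps inverse_eq_divide)
  finally show ?case .
qed

text \<open>With w = \<beta> + 1, the harmonic sum in the product bound supplies the decay exp (- w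
  ln p), and the remaining terms of the exponent are at most w^2 - w = \<beta>^2 + \<beta>.\<close>

lemma abs_binom_coeff_le:
  assumes "0 < \<beta>" "p \<ge> 2"
  shows "\<bar>binom_coeff \<beta> p\<bar> \<le> exp (\<beta>\<^sup>2 + \<beta>) / real p powr (\<beta> + 1)"
proof -
  define w where "w = \<beta> + 1"
  have "binom_coeff \<beta> 2 = - \<beta> * (1 - w / 2)"
    by (simp add: numeral_2_eq_2 binom_coeff_Suc w_def)
  then have "\<bar>binom_coeff \<beta> 2\<bar> = \<beta> * \<bar>1 - w / 2\<bar>"
    using assms by (simp add: abs_mult)
  \<comment> \<open>Both factors are estimated by z \<le> exp (z - 1).\<close>
  also have "\<dots> \<le> exp (\<beta> - 1) * exp (\<bar>1 - w / 2\<bar> - 1)"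
    using exp_ge_add_one_self[of "\<beta> - 1"] exp_ge_add_one_self[of "\<bar>1 - w / 2\<bar> - 1"]
    by (intro mult_mono) auto
  also have "\<dots> = exp (w - 3 + \<bar>1 - w / 2\<bar>)"
    by (simp add: exp_add[symmetric] w_def)
  finally have c2: "\<bar>binom_coeff \<beta> 2\<bar> \<le> exp (w - 3 + \<bar>1 - w / 2\<bar>)" .
  have "w * (ln (real p) + 1 / 2) \<le> w * harm p"
    using assms by (intro mult_left_mono harm_ge_ln_plus_half) (auto simp: w_def)
  moreover have "w\<^sup>2 / 2 * (2 / 5 - 1 / (real p + 1 / 2)) \<le> w\<^sup>2 / 2 * (2 / 5)"
    by (intro mult_left_mono) auto
  ultimately have "w\<^sup>2 / 2 * (2 / 5 - 1 / (real p + 1 / 2)) - w * (harm p - 3 / 2)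
      \<le> w\<^sup>2 / 5 - w * ln (real p) + w"
    unfolding distrib_left right_diff_distrib by linarith
  then have "\<bar>binom_coeff \<beta> p\<bar> \<le> exp (w - 3 + \<bar>1 - w / 2\<bar>) * exp (w\<^sup>2 / 5 - w * ln (real p) + w)"
    using abs_binom_coeff_le_aux[OF assms(2) w_def]
    by (elim order_trans) (intro mult_mono c2, auto)
  also have "\<dots> = exp (w - 3 + \<bar>1 - w / 2\<bar> + (w\<^sup>2 / 5 - w * ln (real p) + w))"
    by (simp only: exp_add)
  also have "w - 3 + \<bar>1 - w / 2\<bar> + (w\<^sup>2 / 5 - w * ln (real p) + w) \<le> w\<^sup>2 - w - w * ln (real p)"
  proof -
    \<comment> \<open>Completing the square in the cases \<open>w \<le> 2\<close> and \<open>w \<ge> 2\<close>.\<close>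
    have "0 \<le> 4 / 5 * (w - 25 / 16)\<^sup>2" "0 \<le> 4 / 5 * (w - 35 / 16)\<^sup>2"
      by simp_all
    then show ?thesis
      by (auto simp: power2_eq_square algebra_simps abs_if)
  qed
  also have "w\<^sup>2 - w - w * ln (real p) = \<beta>\<^sup>2 + \<beta> - (\<beta> + 1) * ln (real p)"
    by (simp add: w_def power2_eq_square algebra_simps)
  also have "exp \<dots> = exp (\<beta>\<^sup>2 + \<beta>) / real p powr (\<beta> + 1)"
    using assms by (simp only: exp_diff powr_def) simp
  finally show ?thesis by simp
qed

lemma inverse_powr_plus_one: "1 / y powr (\<beta> + 1) = y powr (- \<beta> - 1)" for y \<beta> :: real
  using powr_minus_divide[of y "\<beta> + 1"] by (simp only: minus_add_distrib add_uminus_conv_diff)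

text \<open>Mean value theorem for z^(-\<beta>) on [p, p + 1]: the derivative is smallest in
  absolute value at p + 1. Summation over p then telescopes.\<close>

lemma powr_telescope_le:
  fixes \<beta> :: real
  assumes "0 < \<beta>" "p > 0"
  shows "1 / real (Suc p) powr (\<beta> + 1) \<le> (real p powr (- \<beta>) - real (Suc p) powr (- \<beta>)) / \<beta>"
proof -
  have "\<exists>z>real p. z < real (Suc p) \<and>
      real (Suc p) powr (- \<beta>) - real p powr (- \<beta>) = (real (Suc p) - real p) * (- \<beta> * z powr (- \<beta> - 1))"
    using assms by (intro MVT2) (auto intro!: derivative_eq_intros simp: powr_diff)
  then obtain z where z: "z > real p" "z < real (Suc p)"
    and eq: "real (Suc p) powr (- \<beta>) - real p powr (- \<beta>) = - \<beta> * z powr (- \<beta> - 1)"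
    by auto
  have "real (Suc p) powr (- \<beta> - 1) \<le> z powr (- \<beta> - 1)"
    using z assms by (intro powr_mono2') auto
  then have "\<beta> * (1 / real (Suc p) powr (\<beta> + 1)) \<le> \<beta> * z powr (- \<beta> - 1)"
    unfolding inverse_powr_plus_one using assms by simp
  then show ?thesis
    using eq assms by (simp add: pos_le_divide_eq mult.commute)
qed

text \<open>The subtracted \<open>real m powr (- \<beta>)\<close> is what makes the induction on
  \<open>m\<close> telescope; it is dropped when the tail is estimated.\<close>

lemma sum_abs_binom_coeff_le:
  assumes "0 < \<beta>" "N > 0" "N \<le> m"
  shows "(\<Sum>p\<in>{N<..m}. \<bar>binom_coeff \<beta> p\<bar>)
    \<le> exp (\<beta>\<^sup>2 + \<beta>) / \<beta> * (real N powr (- \<beta>) - real m powr (- \<beta>))"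
  using assms(3)
proof (induction m rule: dec_induct)
  case (step m)
  have "\<bar>binom_coeff \<beta> (Suc m)\<bar> \<le> exp (\<beta>\<^sup>2 + \<beta>) * (1 / real (Suc m) powr (\<beta> + 1))"
    using abs_binom_coeff_le[of \<beta> "Suc m"] step assms by simp
  also have "\<dots> \<le> exp (\<beta>\<^sup>2 + \<beta>) * ((real m powr (- \<beta>) - real (Suc m) powr (- \<beta>)) / \<beta>)"
    using assms step by (intro mult_left_mono powr_telescope_le) auto
  finally have "\<bar>binom_coeff \<beta> (Suc m)\<bar>
      \<le> exp (\<beta>\<^sup>2 + \<beta>) * ((real m powr (- \<beta>) - real (Suc m) powr (- \<beta>)) / \<beta>)" .
  moreover have "{N<..Suc m} = insert (Suc m) {N<..m}"
    using step by auto
  ultimately show ?case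
    using step.IH by (simp add: right_diff_distrib diff_divide_distrib)
qed simp

lemma summable_abs_binom_coeff:
  assumes "0 < \<beta>"
  shows "summable (\<lambda>p. \<bar>binom_coeff \<beta> p\<bar>)"
proof (rule summable_comparison_test_ev)
  show "eventually (\<lambda>p. norm \<bar>binom_coeff \<beta> p\<bar> \<le> exp (\<beta>\<^sup>2 + \<beta>) * real p powr (- \<beta> - 1)) sequentially"
    using eventually_ge_at_top[of 2]
  proof eventually_elim
    case (elim p)
    show ?case
      using abs_binom_coeff_le[OF assms elim] unfolding inverse_powr_plus_one[symmetric] by simp
  qed
  show "summable (\<lambda>p. exp (\<beta>\<^sup>2 + \<beta>) * real p powr (- \<beta> - 1))"
    using assms by (intro summable_mult) (simp add: summable_real_powr_iff)
qed

text \<open>For 0 \<le> u < 1 the powers of u are at most 1, so differences of partial sums are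
  bounded by sums of coefficients, uniformly in the upper index and in u; the bound survives the
  limit.\<close>

lemma binom_remainder_bound:
  assumes "0 < \<beta>" "N > 0" "0 \<le> u" "u < 1"
  shows "\<bar>(1 - u) powr \<beta> - (\<Sum>p\<le>N. binom_coeff \<beta> p * u ^ p)\<bar>
    \<le> exp (\<beta>\<^sup>2 + \<beta>) / (\<beta> * real N powr \<beta>)"
proof (rule LIMSEQ_le_const2)
  have "(\<lambda>m. \<Sum>p\<le>m. binom_coeff \<beta> p * u ^ p) \<longlonglongrightarrow> (1 - u) powr \<beta>"
    using binom_coeff_sums[of u \<beta>] assms by (simp add: sums_def_le)
  then show "(\<lambda>m. \<bar>(\<Sum>p\<le>m. binom_coeff \<beta> p * u ^ p) - (\<Sum>p\<le>N. binom_coeff \<beta> p * u ^ p)\<bar>)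
      \<longlonglongrightarrow> \<bar>(1 - u) powr \<beta> - (\<Sum>p\<le>N. binom_coeff \<beta> p * u ^ p)\<bar>"
    by (intro tendsto_intros)
  have "\<bar>(\<Sum>p\<le>m. binom_coeff \<beta> p * u ^ p) - (\<Sum>p\<le>N. binom_coeff \<beta> p * u ^ p)\<bar>
      \<le> exp (\<beta>\<^sup>2 + \<beta>) / (\<beta> * real N powr \<beta>)" if "m \<ge> N" for m
  proof -
    have "(\<Sum>p\<le>m. binom_coeff \<beta> p * u ^ p) - (\<Sum>p\<le>N. binom_coeff \<beta> p * u ^ p)
        = (\<Sum>p\<in>{..m} - {..N}. binom_coeff \<beta> p * u ^ p)"
      using that by (subst sum_diff) auto
    also have "{..m} - {..N} = {N<..m}" by auto
    also have "\<bar>\<Sum>p\<in>{N<..m}. binom_coeff \<beta> p * u ^ p\<bar> \<le> (\<Sum>p\<in>{N<..m}. \<bar>binom_coeff \<beta> p\<bar>)"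
    proof (rule order_trans[OF sum_abs sum_mono])
      fix p show "\<bar>binom_coeff \<beta> p * u ^ p\<bar> \<le> \<bar>binom_coeff \<beta> p\<bar>"
        using assms by (simp add: abs_mult mult_left_le power_le_one)
    qed
    also have "\<dots> \<le> exp (\<beta>\<^sup>2 + \<beta>) / \<beta> * (real N powr (- \<beta>) - real m powr (- \<beta>))"
      using that assms by (intro sum_abs_binom_coeff_le)
    also have "\<dots> \<le> exp (\<beta>\<^sup>2 + \<beta>) / \<beta> * real N powr (- \<beta>)"
      using assms by (intro mult_left_mono) auto
    also have "\<dots> = exp (\<beta>\<^sup>2 + \<beta>) / (\<beta> * real N powr \<beta>)"
      by (simp add: powr_minus_divide)
    finally show ?thesis .
  qed
  then show "\<exists>k. \<forall>m\<ge>k. \<bar>(\<Sum>p\<le>m. binom_coeff \<beta> p * u ^ p) - (\<Sum>p\<le>N. binom_coeff \<beta> p * u ^ p)\<bar>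
      \<le> exp (\<beta>\<^sup>2 + \<beta>) / (\<beta> * real N powr \<beta>)" by blast
qed

section \<open>Differentiability classes on a compact interval\<close>

lemma deriv_Icc_eqI:
  assumes "a < b" "t \<in> {a..b}" "(f has_real_derivative D) (at t within {a..b})"
  shows "deriv_Icc a b f t = D"
  unfolding deriv_Icc_def using assms
  by (intro vector_derivative_within_closed_interval)
     (auto simp: has_real_derivative_iff_has_vector_derivative)

lemma has_real_derivative_deriv_Icc:
  assumes "a < b" "t \<in> {a..b}" "f differentiable_on {a..b}"
  shows "(f has_real_derivative deriv_Icc a b f t) (at t within {a..b})"
proof -
  obtain D where "(f has_real_derivative D) (at t within {a..b})"
    using assms by (meson differentiable_on_def real_differentiable_def)
  with deriv_Icc_eqI[OF assms(1,2) this] show ?thesis by simp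
qed

text \<open>Values outside the interval do not matter. This permits replacing
  \<open>deriv_Icc\<close> by an explicit derivative that agrees with it only on the
  interval.\<close>

lemma C_Icc_cong_imp:
  assumes "a < b" "\<And>t. t \<in> {a..b} \<Longrightarrow> f t = g t" "C_Icc k a b f"
  shows "C_Icc k a b g"
  using assms(2,3)
proof (induction k arbitrary: f g)
  case 0
  then show ?case using continuous_on_cong[of "{a..b}" "{a..b}" f g] by simp
next
  case (Suc k)
  have df: "(f has_real_derivative deriv_Icc a b f t) (at t within {a..b})" if "t \<in> {a..b}" for t
    using has_real_derivative_deriv_Icc[OF assms(1) that] Suc.prems by auto
  have dg: "(g has_real_derivative deriv_Icc a b f t) (at t within {a..b})" if "t \<in> {a..b}" for t
    using has_field_derivative_transform_within[OF df[OF that] zero_less_one that] Suc.prems(1) by metis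
  have "g differentiable_on {a..b}"
    using dg by (meson differentiable_on_def real_differentiable_def)
  moreover have "C_Icc k a b (deriv_Icc a b g)"
  proof (rule Suc.IH)
    show "C_Icc k a b (deriv_Icc a b f)" using Suc.prems by simp
    show "deriv_Icc a b f t = deriv_Icc a b g t" if "t \<in> {a..b}" for t
      using deriv_Icc_eqI[OF assms(1) that dg[OF that]] by simp
  qed
  ultimately show ?case by simp
qed

lemma C_Icc_SucI:
  assumes "a < b" "\<And>t. t \<in> {a..b} \<Longrightarrow> (f has_real_derivative g t) (at t within {a..b})" "C_Icc k a b g"
  shows "C_Icc (Suc k) a b f"
proof -
  have "C_Icc k a b (deriv_Icc a b f)"
    using deriv_Icc_eqI[OF assms(1) _ assms(2)] by (intro C_Icc_cong_imp[OF assms(1) _ assms(3)]) simp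
  moreover have "f differentiable_on {a..b}"
    using assms(2) by (meson differentiable_on_def real_differentiable_def)
  ultimately show ?thesis by simp
qed

lemma C_Icc_SucD: "C_Icc (Suc k) a b f \<Longrightarrow> C_Icc k a b f"
proof (induction k arbitrary: f)
  case 0
  then show ?case by (simp add: differentiable_imp_continuous_on)
next
  case (Suc k)
  then show ?case using C_Icc.simps(2) by blast
qed

lemma C_Icc_add:
  assumes "a < b" "C_Icc k a b f" "C_Icc k a b g"
  shows "C_Icc k a b (\<lambda>t. f t + g t)"
  using assms(2,3)
proof (induction k arbitrary: f g)
  case 0
  then show ?case by (simp add: continuous_on_add)
next
  case (Suc k)
  then show ?case
    by (intro C_Icc_SucI[OF assms(1), where g = "\<lambda>t. deriv_Icc a b f t + deriv_Icc a b g t"]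
          DERIV_add has_real_derivative_deriv_Icc[OF assms(1)] Suc.IH) auto
qed

lemma C_Icc_mult_id:
  assumes "a < b" "C_Icc k a b f"
  shows "C_Icc k a b (\<lambda>t. t * f t)"
  using assms(2)
proof (induction k arbitrary: f)
  case 0
  then show ?case by (simp add: continuous_on_mult)
next
  case (Suc k)
  have "((\<lambda>t. t * f t) has_real_derivative f t + t * deriv_Icc a b f t) (at t within {a..b})"
    if "t \<in> {a..b}" for t
    using has_real_derivative_deriv_Icc[OF assms(1) that, of f] Suc.prems
    by (auto intro!: derivative_eq_intros)
  then show ?case
    using Suc.prems C_Icc_SucD
    by (intro C_Icc_SucI[OF assms(1), where g = "\<lambda>t. f t + t * deriv_Icc a b f t"] C_Icc_add[OF assms(1)] Suc.IH) auto
qed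

section \<open>The iterates \<open>x0\<close> and \<open>x1\<close>\<close>

lemma C_Icc_x0:
  assumes "a < b" "C_Icc (i + k) a b x"
  shows "C_Icc k a b (x0 a b x i)"
  using assms(2)
proof (induction i arbitrary: k)
  case (Suc i)
  have "C_Icc (Suc k) a b (x0 a b x i)"
    using Suc.prems by (intro Suc.IH) simp
  then show ?case by (auto intro: C_Icc_mult_id[OF assms(1)])
qed simp

text \<open>In the variable ln t the operator t d/dt is plain differentiation. The later lemmas on a
  sequence \<open>f\<close> assume only this chain relation and continuity of the last
  member.\<close>

lemma has_real_derivative_x0:
  assumes "0 < a" "a < b" "C_Icc (n + 1) a b x" "i \<le> n" "t \<in> {a..b}"
  shows "(x0 a b x i has_real_derivative x0 a b x (Suc i) t / t) (at t within {a..b})"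
proof -
  have "C_Icc (Suc (n - i)) a b (x0 a b x i)"
    using C_Icc_x0[OF assms(2), of i "Suc (n - i)" x] assms by simp
  then show ?thesis
    using has_real_derivative_deriv_Icc[OF assms(2,5), of "x0 a b x i"] assms by simp
qed

text \<open>The two recursions differ only in where the factor t is applied. Consequently
  \<open>x1 a b x n \<tau>\<close> d\<tau> is \<open>x0 a b x (Suc n) \<tau>\<close> d\<tau> /
  \<tau>, which connects the error bound with the Taylor remainder.\<close>

lemma x1_eq:
  assumes "0 < a" "a < b" "C_Icc (n + 1) a b x" "k \<le> n" "t \<in> {a..b}"
  shows "x1 a b x k t = x0 a b x (Suc k) t / t"
  using assms(4,5)
proof (induction k arbitrary: t)
  case 0
  then show ?case using assms(1) by simp
next
  case (Suc k)
  have "t * x1 a b x k t = x0 a b x (Suc k) t" if "t \<in> {a..b}" for t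
    using Suc.IH[OF _ that] Suc.prems(1) that assms(1) by simp
  then have "((\<lambda>t. t * x1 a b x k t) has_real_derivative x0 a b x (Suc (Suc k)) t / t) (at t within {a..b})"
    using has_field_derivative_transform_within[OF has_real_derivative_x0[OF assms(1-3) Suc.prems]
        zero_less_one Suc.prems(2)] by metis
  from deriv_Icc_eqI[OF assms(2) Suc.prems(2) this] show ?case by simp
qed

section \<open>Logarithmic kernels\<close>

lemma continuous_on_ln_powr:
  fixes \<beta> :: real
  assumes "0 < a" "0 < \<beta>"
  shows "continuous_on {a..t} (\<lambda>\<tau>. ln (t / \<tau>) powr \<beta>)"
  using assms by (intro continuous_on_powr' continuous_intros) (auto simp: ln_ge_zero)

text \<open>An antiderivative of ln (t / \<tau>)^(\<beta> - 1) / \<tau> is - ln (t / \<tau>)^\<beta>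
  / \<beta>. For \<beta> < 1 the integrand may be singular at \<tau> = t, so the rule used asks for
  derivatives in the interior only, and integrability is part of the conclusion.\<close>

lemma log_kernel_by_parts:
  fixes \<beta> :: real
  assumes "0 < a" "a < t" "0 < \<beta>"
    and f: "\<And>\<tau>. \<tau> \<in> {a..t} \<Longrightarrow> (f has_real_derivative g \<tau> / \<tau>) (at \<tau> within {a..t})"
    and g: "continuous_on {a..t} g"
  shows "((\<lambda>\<tau>. ln (t / \<tau>) powr (\<beta> - 1) * (f \<tau> / \<tau>)) has_integral
    (ln (t / a) powr \<beta> * f a + integral {a..t} (\<lambda>\<tau>. ln (t / \<tau>) powr \<beta> * (g \<tau> / \<tau>))) / \<beta>) {a..t}"
proof -
  let ?I = "integral {a..t} (\<lambda>\<tau>. ln (t / \<tau>) powr \<beta> * (g \<tau> / \<tau>))"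
  have "((\<lambda>\<tau>. ln (t / \<tau>) powr (\<beta> - 1) / \<tau> * f \<tau>) has_integral
    (ln (t / a) powr \<beta> * f a + ?I) / \<beta>) {a..t}"
  proof (rule integration_by_parts_interior[OF bounded_bilinear_mult])
    show "a \<le> t" using assms by simp
    show "continuous_on {a..t} (\<lambda>\<tau>. - (ln (t / \<tau>) powr \<beta>) / \<beta>)"
      using assms by (intro continuous_intros continuous_on_ln_powr) auto
    show "continuous_on {a..t} f"
      using f DERIV_continuous by (metis continuous_on_eq_continuous_within)
    fix \<tau> assume \<tau>: "\<tau> \<in> {a<..<t}"
    then have pos: "ln (t / \<tau>) > 0" "\<tau> > 0" using assms by auto
    have "((\<lambda>\<tau>. ln (t / \<tau>)) has_real_derivative - 1 / \<tau>) (at \<tau>)"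
      using pos \<tau> assms by (auto intro!: derivative_eq_intros simp: power2_eq_square)
    from DERIV_cdivide[OF DERIV_minus[OF DERIV_fun_powr[OF this pos(1), of \<beta>]], of \<beta>]
    show "((\<lambda>\<tau>. - (ln (t / \<tau>) powr \<beta>) / \<beta>) has_vector_derivative ln (t / \<tau>) powr (\<beta> - 1) / \<tau>) (at \<tau>)"
      unfolding has_real_derivative_iff_has_vector_derivative[symmetric]
      using assms by simp
    show "(f has_vector_derivative g \<tau> / \<tau>) (at \<tau>)"
      using f[of \<tau>] \<tau> by (simp add: has_real_derivative_iff_has_vector_derivative[symmetric] at_within_Icc_at)
  next
    have "(\<lambda>\<tau>. ln (t / \<tau>) powr \<beta> * (g \<tau> / \<tau>)) integrable_on {a..t}"
      using assms by (intro integrable_continuous_interval continuous_intros continuous_on_ln_powr) auto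
    then have "((\<lambda>\<tau>. - 1 / \<beta> * (ln (t / \<tau>) powr \<beta> * (g \<tau> / \<tau>))) has_integral (- 1 / \<beta> * ?I)) {a..t}"
      by (intro has_integral_mult_right integrable_integral)
    \<comment> \<open>The boundary term at \<tau> = t drops out because
      \<open>0 powr \<beta>\<close> is 0.\<close>
    moreover have "- (ln (t / t) powr \<beta>) / \<beta> * f t - - (ln (t / a) powr \<beta>) / \<beta> * f a
        - (ln (t / a) powr \<beta> * f a + ?I) / \<beta> = - 1 / \<beta> * ?I"
      using assms by (simp add: field_simps)
    ultimately show "((\<lambda>\<tau>. - (ln (t / \<tau>) powr \<beta>) / \<beta> * (g \<tau> / \<tau>)) has_integral
        - (ln (t / t) powr \<beta>) / \<beta> * f t - - (ln (t / a) powr \<beta>) / \<beta> * f a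
        - (ln (t / a) powr \<beta> * f a + ?I) / \<beta>) {a..t}"
      by simp
  qed
  then show ?thesis by simp
qed

section \<open>Differentiating the kernel integral in its upper limit\<close>

text \<open>Only z = 0 is delicate: the difference quotient there is at most |h|^(\<gamma> - 1),
  which tends to 0 since \<gamma> > 1.\<close>

lemma has_real_derivative_max_0_powr:
  fixes \<gamma> z :: real
  assumes "1 < \<gamma>"
  shows "((\<lambda>z. max 0 z powr \<gamma>) has_real_derivative \<gamma> * max 0 z powr (\<gamma> - 1)) (at z)"
proof (cases z "0::real" rule: linorder_cases)
  case greater
  have "((\<lambda>z. z powr \<gamma>) has_real_derivative \<gamma> * max 0 z powr (\<gamma> - 1)) (at z)"
    using greater has_real_derivative_powr[OF greater, of \<gamma>] by simp
  then show ?thesis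
    by (rule has_field_derivative_transform_within_open[of _ _ _ "{0<..}"]) (use greater in auto)
next
  case less
  have "((\<lambda>z. 0) has_real_derivative \<gamma> * max 0 z powr (\<gamma> - 1)) (at z)"
    using less by simp
  then show ?thesis
    by (rule has_field_derivative_transform_within_open[of _ _ _ "{..<0}"]) (use less in auto)
next
  case equal
  have "((\<lambda>h. max 0 h powr \<gamma> / h) \<longlongrightarrow> 0) (at 0)"
  proof (rule Lim_null_comparison)
    have "((\<lambda>h. \<bar>h\<bar> powr (\<gamma> - 1)) \<longlongrightarrow> \<bar>0\<bar> powr (\<gamma> - 1)) (at (0::real))"
      using assms by (intro tendsto_powr' tendsto_intros) auto
    then show "((\<lambda>h. \<bar>h\<bar> powr (\<gamma> - 1)) \<longlongrightarrow> 0) (at (0::real))" by simp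
    show "\<forall>\<^sub>F h in at 0. norm (max 0 h powr \<gamma> / h) \<le> \<bar>h\<bar> powr (\<gamma> - 1)"
      using assms by (intro always_eventually allI) (auto simp: powr_diff max_def divide_nonneg_neg)
  qed
  then show ?thesis
    using equal by (simp add: DERIV_def)
qed

text \<open>The kernel vanishes at \<tau> = s, so the moving endpoint contributes nothing. Since
  \<gamma> > 1, the kernel extended by 0 has a continuous s-derivative across \<tau> = s, and the
  Leibniz rule applies on a fixed interval.\<close>

lemma has_real_derivative_log_kernel_integral:
  fixes \<gamma> :: real
  assumes "0 < a" "a < t" "t < b" "1 < \<gamma>" and h: "continuous_on {a..b} h"
  shows "((\<lambda>s. integral {a..s} (\<lambda>\<tau>. ln (s / \<tau>) powr \<gamma> * h \<tau>)) has_real_derivative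
    \<gamma> / t * integral {a..t} (\<lambda>\<tau>. ln (t / \<tau>) powr (\<gamma> - 1) * h \<tau>)) (at t)"
proof -
  \<comment> \<open>Extending the kernel by 0 to \<open>\<tau> > s\<close> makes the domain of integration independent of \<open>s\<close>.\<close>
  define K where "K \<delta> s \<tau> = max 0 (ln (s / \<tau>)) powr \<delta> * h \<tau>" for \<delta> s \<tau> :: real
  have cont: "continuous_on ({a<..<b} \<times> {a..b}) (\<lambda>(s, \<tau>). K \<delta> s \<tau>)" if "0 < \<delta>" for \<delta>
  proof -
    have "continuous_on ({a<..<b} \<times> {a..b}) (\<lambda>p. h (snd p))"
      by (rule continuous_on_compose2[OF h]) (auto intro: continuous_intros)
    then show ?thesis
      unfolding K_def split_beta using assms that
      by (intro continuous_intros continuous_on_powr') auto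
  qed
  have cont1: "continuous_on {a..b} (K \<delta> s)" if "0 < \<delta>" "s \<in> {a<..<b}" for \<delta> s
    unfolding K_def using assms that by (intro continuous_intros continuous_on_powr') auto
  have restrict: "integral {a..b} (K \<delta> s) = integral {a..s} (\<lambda>\<tau>. ln (s / \<tau>) powr \<delta> * h \<tau>)"
    if "0 < \<delta>" "s \<in> {a<..<b}" for \<delta> s
  proof -
    have "integral {a..b} (K \<delta> s) = integral {a..s} (K \<delta> s) + integral {s..b} (K \<delta> s)"
      using that integrable_continuous_interval[OF cont1[OF that]]
      by (intro Henstock_Kurzweil_Integration.integral_combine[symmetric]) auto
    also have "integral {s..b} (K \<delta> s) = integral {s..b} (\<lambda>_. 0)"
      using that assms by (intro integral_cong) (auto simp: K_def max_def)
    also have "integral {a..s} (K \<delta> s) = integral {a..s} (\<lambda>\<tau>. ln (s / \<tau>) powr \<delta> * h \<tau>)"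
      using that assms by (intro integral_cong) (auto simp: K_def max_def)
    finally show ?thesis by simp
  qed
  have "((\<lambda>s. integral (cbox a b) (K \<gamma> s)) has_field_derivative
      integral (cbox a b) (\<lambda>\<tau>. \<gamma> / t * K (\<gamma> - 1) t \<tau>)) (at t within {a<..<b})"
  proof (rule leibniz_rule_field_derivative[where fx = "\<lambda>s \<tau>. \<gamma> / s * K (\<gamma> - 1) s \<tau>"])
    fix s \<tau> assume s: "s \<in> {a<..<b}" "\<tau> \<in> cbox a b"
    then have pos: "s > 0" "\<tau> > 0" using assms by auto
    have "((\<lambda>s. ln (s / \<tau>)) has_real_derivative 1 / s) (at s within {a<..<b})"
      using pos by (auto intro!: derivative_eq_intros)
    from DERIV_chain2[OF has_real_derivative_max_0_powr[OF assms(4)] this]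
    have "((\<lambda>s. max 0 (ln (s / \<tau>)) powr \<gamma>) has_real_derivative
        \<gamma> * max 0 (ln (s / \<tau>)) powr (\<gamma> - 1) * (1 / s)) (at s within {a<..<b})" .
    from DERIV_cmult_right[OF this, of "h \<tau>"]
    show "((\<lambda>s. K \<gamma> s \<tau>) has_field_derivative \<gamma> / s * K (\<gamma> - 1) s \<tau>) (at s within {a<..<b})"
      by (simp add: K_def mult_ac)
  next
    show "K \<gamma> s integrable_on cbox a b" if "s \<in> {a<..<b}" for s
      using integrable_continuous_interval[OF cont1] that assms by simp
  next
    have "continuous_on ({a<..<b} \<times> {a..b}) (\<lambda>p. \<gamma> / fst p * (case p of (s, \<tau>) \<Rightarrow> K (\<gamma> - 1) s \<tau>))"
      using assms by (intro continuous_on_mult cont continuous_intros) auto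
    then show "continuous_on ({a<..<b} \<times> cbox a b) (\<lambda>(s, \<tau>). \<gamma> / s * K (\<gamma> - 1) s \<tau>)"
      by (simp add: split_beta)
  qed (use assms in auto)
  then have "((\<lambda>s. integral {a..b} (K \<gamma> s)) has_real_derivative \<gamma> / t * integral {a..b} (K (\<gamma> - 1) t)) (at t)"
    using assms at_within_open[of t "{a<..<b}"] by (simp del: at_within_open)
  then have "((\<lambda>s. integral {a..b} (K \<gamma> s)) has_real_derivative
      \<gamma> / t * integral {a..t} (\<lambda>\<tau>. ln (t / \<tau>) powr (\<gamma> - 1) * h \<tau>)) (at t)"
    using restrict[of "\<gamma> - 1" t] assms by simp
  then show ?thesis
    by (rule has_field_derivative_transform_within_open[of _ _ _ "{a<..<b}"])
       (use restrict[of \<gamma>] assms in auto)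
qed

section \<open>Taylor expansion of the Hadamard derivative\<close>

lemma has_real_derivative_restrict_Icc:
  assumes "t \<le> b" "\<And>\<tau>. \<tau> \<in> {a..b} \<Longrightarrow> (f has_real_derivative g \<tau>) (at \<tau> within {a..b})" "\<tau> \<in> {a..t}"
  shows "(f has_real_derivative g \<tau>) (at \<tau> within {a..t})"
  by (rule DERIV_subset[OF assms(2)]) (use assms in auto)

lemma continuous_on_deriv_chain:
  fixes f :: "nat \<Rightarrow> real \<Rightarrow> real"
  assumes "\<And>i \<tau>. i \<le> n \<Longrightarrow> \<tau> \<in> S \<Longrightarrow> (f i has_real_derivative f (Suc i) \<tau> / \<tau>) (at \<tau> within S)"
    and "continuous_on S (f (Suc n))" and "i \<le> Suc n"
  shows "continuous_on S (f i)"
proof (cases "i = Suc n")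
  case False
  then show ?thesis
    using assms(1)[of i] assms(3) DERIV_continuous by (metis continuous_on_eq_continuous_within le_Suc_eq)
qed (use assms in simp)

lemma Gamma_plus1_real: "0 < z \<Longrightarrow> Gamma (z + 1) = z * Gamma z" for z :: real
  by (intro Gamma_plus1) (auto elim!: nonpos_Ints_cases)

text \<open>The left-hand side does not depend on \<open>m\<close>: each step is one integration by
  parts together with \<Gamma>(z + 1) = z \<Gamma>(z). The right-hand side is its value at
  \<open>m = 1\<close>, the form in which differentiating the Hadamard integral delivers it.\<close>

lemma log_taylor_step:
  fixes f :: "nat \<Rightarrow> real \<Rightarrow> real"
  assumes "0 < a" "a < t" "\<alpha> < 1"
    and f: "\<And>i \<tau>. i \<le> n \<Longrightarrow> \<tau> \<in> {a..t} \<Longrightarrow> (f i has_real_derivative f (Suc i) \<tau> / \<tau>) (at \<tau> within {a..t})"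
    and c: "continuous_on {a..t} (f (Suc n))"
    and "1 \<le> m" "m \<le> n"
  shows "(\<Sum>i\<le>m. f i a * ln (t / a) powr (real i - \<alpha>) / Gamma (real i + 1 - \<alpha>))
      + 1 / Gamma (real m + 1 - \<alpha>) * integral {a..t} (\<lambda>\<tau>. ln (t / \<tau>) powr (real m - \<alpha>) * (f (Suc m) \<tau> / \<tau>))
    = f 0 a * ln (t / a) powr (- \<alpha>) / Gamma (1 - \<alpha>) + f 1 a * ln (t / a) powr (1 - \<alpha>) / Gamma (2 - \<alpha>)
      + 1 / Gamma (2 - \<alpha>) * integral {a..t} (\<lambda>\<tau>. ln (t / \<tau>) powr (1 - \<alpha>) * (f 2 \<tau> / \<tau>))"
  using assms(6,7)
proof (induction m rule: dec_induct)
  case base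
  then show ?case by (simp add: numeral_2_eq_2)
next
  case (step m)
  let ?I = "\<lambda>m. integral {a..t} (\<lambda>\<tau>. ln (t / \<tau>) powr (real m - \<alpha>) * (f (Suc m) \<tau> / \<tau>))"
  let ?\<beta> = "real m + 1 - \<alpha>"
  have \<beta>: "?\<beta> > 0" using assms by simp
  have "((\<lambda>\<tau>. ln (t / \<tau>) powr (?\<beta> - 1) * (f (Suc m) \<tau> / \<tau>)) has_integral
      (ln (t / a) powr ?\<beta> * f (Suc m) a
        + integral {a..t} (\<lambda>\<tau>. ln (t / \<tau>) powr ?\<beta> * (f (Suc (Suc m)) \<tau> / \<tau>))) / ?\<beta>) {a..t}"
    using step.prems continuous_on_deriv_chain[OF f c] assms(1-3) \<beta>
    by (intro log_kernel_by_parts f) auto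
  then have eq: "?I m = (ln (t / a) powr ?\<beta> * f (Suc m) a + ?I (Suc m)) / ?\<beta>"
    by (subst integral_unique[symmetric]) (auto simp: algebra_simps)
  have G: "Gamma (real (Suc m) + 1 - \<alpha>) = ?\<beta> * Gamma ?\<beta>"
    using Gamma_plus1_real[OF \<beta>] by (simp add: algebra_simps)
  have "1 / Gamma ?\<beta> * ?I m = f (Suc m) a * ln (t / a) powr (real (Suc m) - \<alpha>) / Gamma (real (Suc m) + 1 - \<alpha>)
      + 1 / Gamma (real (Suc m) + 1 - \<alpha>) * ?I (Suc m)"
    unfolding eq G using \<beta> Gamma_real_pos[OF \<beta>]
    by (simp add: add_divide_distrib distrib_left mult_ac add.commute)
  then show ?case
    using step by simp
qed

text \<open>Two integrations by parts make the kernel \<open>ln (t / \<tau>) powr (2 - \<alpha>)\<close> continuously differentiable in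
  \<open>t\<close>, so the derivative can be taken under the integral sign; this is where \<open>1 \<le> n\<close> is used.\<close>

lemma hadamard_integral_has_real_derivative:
  fixes f :: "nat \<Rightarrow> real \<Rightarrow> real"
  assumes "0 < a" "a < t" "t < b" "0 < \<alpha>" "\<alpha> < 1" "1 \<le> n"
    and f: "\<And>i \<tau>. i \<le> n \<Longrightarrow> \<tau> \<in> {a..b} \<Longrightarrow> (f i has_real_derivative f (Suc i) \<tau> / \<tau>) (at \<tau> within {a..b})"
    and c: "continuous_on {a..b} (f (Suc n))"
  shows "(hadamard_integral a \<alpha> (f 0) has_real_derivative
    ((\<Sum>i\<le>n. f i a * ln (t / a) powr (real i - \<alpha>) / Gamma (real i + 1 - \<alpha>))
      + 1 / Gamma (real n + 1 - \<alpha>) * integral {a..t} (\<lambda>\<tau>. ln (t / \<tau>) powr (real n - \<alpha>) * (f (Suc n) \<tau> / \<tau>))) / t)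
    (at t)"
proof -
  define I where "I \<gamma> s = integral {a..s} (\<lambda>\<tau>. ln (s / \<tau>) powr \<gamma> * (f 2 \<tau> / \<tau>))" for \<gamma> s
  have cont: "continuous_on {a..b} (f i)" if "i \<le> Suc n" for i
    using continuous_on_deriv_chain[OF f c] that by blast
  have pos: "Gamma (1 - \<alpha>) > 0" "0 < ln (t / a)"
    using assms by (auto intro: Gamma_real_pos)
  have G: "Gamma (2 - \<alpha>) = (1 - \<alpha>) * Gamma (1 - \<alpha>)"
    using Gamma_plus1_real[of "1 - \<alpha>"] assms by (simp add: algebra_simps)
  have eq: "hadamard_integral a \<alpha> (f 0) s = 1 / Gamma (2 - \<alpha>) *
      (ln (s / a) powr (1 - \<alpha>) * f 0 a + (ln (s / a) powr (2 - \<alpha>) * f 1 a + I (2 - \<alpha>) s) / (2 - \<alpha>))"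
    if s: "s \<in> {a<..<b}" for s
  proof -
    have fs: "(f i has_real_derivative f (Suc i) \<tau> / \<tau>) (at \<tau> within {a..s})"
      if "i \<le> n" "\<tau> \<in> {a..s}" for i \<tau>
      using has_real_derivative_restrict_Icc[OF _ f[OF that(1)] that(2)] s by auto
    have cs: "continuous_on {a..s} (f i)" if "i \<le> Suc n" for i
      using continuous_on_subset[OF cont[OF that], of "{a..s}"] s by auto
    have 1: "((\<lambda>\<tau>. ln (s / \<tau>) powr ((1 - \<alpha>) - 1) * (f 0 \<tau> / \<tau>)) has_integral
        (ln (s / a) powr (1 - \<alpha>) * f 0 a
          + integral {a..s} (\<lambda>\<tau>. ln (s / \<tau>) powr (1 - \<alpha>) * (f 1 \<tau> / \<tau>))) / (1 - \<alpha>)) {a..s}"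
      using assms s fs[of 0] cs[of 1] by (intro log_kernel_by_parts) auto
    have 2: "((\<lambda>\<tau>. ln (s / \<tau>) powr ((2 - \<alpha>) - 1) * (f 1 \<tau> / \<tau>)) has_integral
        (ln (s / a) powr (2 - \<alpha>) * f 1 a
          + integral {a..s} (\<lambda>\<tau>. ln (s / \<tau>) powr (2 - \<alpha>) * (f 2 \<tau> / \<tau>))) / (2 - \<alpha>)) {a..s}"
      using assms s fs[of 1] cs[of 2] by (intro log_kernel_by_parts) (auto simp: numeral_2_eq_2)
    show ?thesis
      using integral_unique[OF 1] integral_unique[OF 2]
      by (simp add: hadamard_integral_def I_def G)
  qed
  have dln: "((\<lambda>s. ln (s / a) powr \<gamma>) has_real_derivative \<gamma> * ln (t / a) powr (\<gamma> - 1) / t) (at t)" for \<gamma>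
  proof -
    have "((\<lambda>s. ln (s / a)) has_real_derivative 1 / t) (at t)"
      using assms by (auto intro!: derivative_eq_intros)
    from DERIV_fun_powr[OF this pos(2), of \<gamma>] show ?thesis by simp
  qed
  have "continuous_on {a..b} (\<lambda>\<tau>. f 2 \<tau> / \<tau>)"
    using assms cont[of 2] by (intro continuous_intros) auto
  from has_real_derivative_log_kernel_integral[OF assms(1-3) _ this, of "2 - \<alpha>"]
  have dI: "(I (2 - \<alpha>) has_real_derivative (2 - \<alpha>) / t * I (1 - \<alpha>) t) (at t)"
    unfolding I_def using assms by simp
  have "((\<lambda>s. 1 / Gamma (2 - \<alpha>) * (ln (s / a) powr (1 - \<alpha>) * f 0 a
        + (ln (s / a) powr (2 - \<alpha>) * f 1 a + I (2 - \<alpha>) s) / (2 - \<alpha>)))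
      has_real_derivative 1 / Gamma (2 - \<alpha>) * ((1 - \<alpha>) * ln (t / a) powr (1 - \<alpha> - 1) / t * f 0 a
        + ((2 - \<alpha>) * ln (t / a) powr (2 - \<alpha> - 1) / t * f 1 a + (2 - \<alpha>) / t * I (1 - \<alpha>) t) / (2 - \<alpha>)))
      (at t)"
    by (rule DERIV_cmult[OF DERIV_add[OF DERIV_cmult_right[OF dln]
          DERIV_cdivide[OF DERIV_add[OF DERIV_cmult_right[OF dln] dI]]]])
  then have der: "(hadamard_integral a \<alpha> (f 0) has_real_derivative
      1 / Gamma (2 - \<alpha>) * ((1 - \<alpha>) * ln (t / a) powr (1 - \<alpha> - 1) / t * f 0 a
        + ((2 - \<alpha>) * ln (t / a) powr (2 - \<alpha> - 1) / t * f 1 a + (2 - \<alpha>) / t * I (1 - \<alpha>) t) / (2 - \<alpha>))) (at t)"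
    by (rule has_field_derivative_transform_within_open[of _ _ _ "{a<..<b}"]) (use assms eq in auto)
  have "1 / Gamma (2 - \<alpha>) * ((1 - \<alpha>) * ln (t / a) powr (1 - \<alpha> - 1) / t * f 0 a
        + ((2 - \<alpha>) * ln (t / a) powr (2 - \<alpha> - 1) / t * f 1 a + (2 - \<alpha>) / t * I (1 - \<alpha>) t) / (2 - \<alpha>))
    = (f 0 a * ln (t / a) powr (- \<alpha>) / Gamma (1 - \<alpha>) + f 1 a * ln (t / a) powr (1 - \<alpha>) / Gamma (2 - \<alpha>)
      + 1 / Gamma (2 - \<alpha>) * I (1 - \<alpha>) t) / t"
  proof -
    have "((2 - \<alpha>) * ln (t / a) powr (2 - \<alpha> - 1) / t * f 1 a + (2 - \<alpha>) / t * I (1 - \<alpha>) t) / (2 - \<alpha>)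
        = (ln (t / a) powr (1 - \<alpha>) * f 1 a + I (1 - \<alpha>) t) / t"
      using assms by (simp add: divide_simps) (simp add: algebra_simps)
    then show ?thesis
      using assms pos(1) unfolding G by (simp add: divide_simps)
  qed
  also have "\<dots> = ((\<Sum>i\<le>n. f i a * ln (t / a) powr (real i - \<alpha>) / Gamma (real i + 1 - \<alpha>))
      + 1 / Gamma (real n + 1 - \<alpha>) * integral {a..t} (\<lambda>\<tau>. ln (t / \<tau>) powr (real n - \<alpha>) * (f (Suc n) \<tau> / \<tau>))) / t"
  proof -
    have "(f i has_real_derivative f (Suc i) \<tau> / \<tau>) (at \<tau> within {a..t})"
      if "i \<le> n" "\<tau> \<in> {a..t}" for i \<tau>
      using has_real_derivative_restrict_Icc[OF _ f[OF that(1)] that(2)] assms by auto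
    moreover have "continuous_on {a..t} (f (Suc n))"
      using c by (rule continuous_on_subset) (use assms in auto)
    ultimately show ?thesis
      unfolding I_def using assms(1-6) log_taylor_step[of a t \<alpha> n f n] by simp
  qed
  finally show ?thesis using der by simp
qed

section \<open>Polynomial kernels\<close>

text \<open>Fundamental theorem for S(u) f(\<tau>) with u = ln (\<tau> / a) / l, which runs from 0
  at \<tau> = a to 1 at \<tau> = t; the factor 1 / l comes from du/d\<tau> = 1 / (l \<tau>).\<close>

lemma log_polynomial_by_parts:
  fixes S S' f g :: "real \<Rightarrow> real" and l :: real
  assumes "0 < a" "a < t" and l: "l = ln (t / a)"
    and S: "\<And>u. (S has_real_derivative S' u) (at u)" and S': "continuous_on UNIV S'"
    and f: "\<And>\<tau>. \<tau> \<in> {a..t} \<Longrightarrow> (f has_real_derivative g \<tau> / \<tau>) (at \<tau> within {a..t})"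
    and g: "continuous_on {a..t} g"
  shows "integral {a..t} (\<lambda>\<tau>. S (ln (\<tau> / a) / l) * (g \<tau> / \<tau>))
    = S 1 * f t - S 0 * f a - 1 / l * integral {a..t} (\<lambda>\<tau>. S' (ln (\<tau> / a) / l) * (f \<tau> / \<tau>))"
proof -
  have "l > 0" using assms by simp
  have cv: "continuous_on {a..t} (\<lambda>\<tau>. ln (\<tau> / a) / l)"
    using assms \<open>l > 0\<close> by (intro continuous_intros) auto
  have cS: "continuous_on UNIV S"
    using S DERIV_isCont by (metis continuous_at_imp_continuous_on)
  have cf: "continuous_on {a..t} f"
    using f DERIV_continuous by (metis continuous_on_eq_continuous_within)
  have i1: "(\<lambda>\<tau>. S (ln (\<tau> / a) / l) * (g \<tau> / \<tau>)) integrable_on {a..t}"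
    using assms(1,2)
    by (intro integrable_continuous_interval continuous_intros continuous_on_compose2[OF cS cv] g) auto
  have i2: "(\<lambda>\<tau>. S' (ln (\<tau> / a) / l) * (f \<tau> / \<tau>)) integrable_on {a..t}"
    using assms(1,2)
    by (intro integrable_continuous_interval continuous_intros continuous_on_compose2[OF S' cv] cf) auto
  have "((\<lambda>\<tau>. 1 / l * (S' (ln (\<tau> / a) / l) * (f \<tau> / \<tau>)) + S (ln (\<tau> / a) / l) * (g \<tau> / \<tau>)) has_integral
      S (ln (t / a) / l) * f t - S (ln (a / a) / l) * f a) {a..t}"
  proof (rule fundamental_theorem_of_calculus)
    fix \<tau> assume \<tau>: "\<tau> \<in> {a..t}"
    then have "((\<lambda>\<tau>. ln (\<tau> / a) / l) has_real_derivative 1 / \<tau> / l) (at \<tau> within {a..t})"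
      using assms(1) \<open>l > 0\<close> by (auto intro!: derivative_eq_intros)
    from DERIV_mult[OF DERIV_chain2[OF S this] f[OF \<tau>]]
    show "((\<lambda>\<tau>. S (ln (\<tau> / a) / l) * f \<tau>) has_vector_derivative
        1 / l * (S' (ln (\<tau> / a) / l) * (f \<tau> / \<tau>)) + S (ln (\<tau> / a) / l) * (g \<tau> / \<tau>)) (at \<tau> within {a..t})"
      by (simp add: has_real_derivative_iff_has_vector_derivative[symmetric] mult_ac add.commute)
  qed (use assms in simp)
  moreover have "((\<lambda>\<tau>. 1 / l * (S' (ln (\<tau> / a) / l) * (f \<tau> / \<tau>)) + S (ln (\<tau> / a) / l) * (g \<tau> / \<tau>)) has_integral
      1 / l * integral {a..t} (\<lambda>\<tau>. S' (ln (\<tau> / a) / l) * (f \<tau> / \<tau>))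
      + integral {a..t} (\<lambda>\<tau>. S (ln (\<tau> / a) / l) * (g \<tau> / \<tau>))) {a..t}"
    by (intro has_integral_add has_integral_mult_right integrable_integral i1 i2)
  ultimately have "S (ln (t / a) / l) * f t - S (ln (a / a) / l) * f a
      = 1 / l * integral {a..t} (\<lambda>\<tau>. S' (ln (\<tau> / a) / l) * (f \<tau> / \<tau>))
      + integral {a..t} (\<lambda>\<tau>. S (ln (\<tau> / a) / l) * (g \<tau> / \<tau>))"
    by (rule has_integral_unique)
  then show ?thesis
    using \<open>l > 0\<close> assms(1) l by simp
qed

section \<open>Partial sums of the binomial series as kernels\<close>

definition binom_poly :: "real \<Rightarrow> nat \<Rightarrow> real \<Rightarrow> real" where
  "binom_poly \<beta> m u = (\<Sum>p\<le>m. binom_coeff \<beta> p * u ^ p)"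

lemma binom_poly_0 [simp]: "binom_poly \<beta> m 0 = 1"
  by (simp add: binom_poly_def sum.atMost_shift)

lemma has_real_derivative_binom_poly:
  "(binom_poly \<beta> m has_real_derivative (\<Sum>p = 1..m. binom_coeff \<beta> p * (real p * u ^ (p - 1)))) (at u)"
proof -
  have "(binom_poly \<beta> m has_real_derivative (\<Sum>p\<le>m. binom_coeff \<beta> p * (real p * u ^ (p - 1)))) (at u)"
    unfolding binom_poly_def by (intro DERIV_sum DERIV_cmult) (auto intro!: derivative_eq_intros)
  also have "(\<Sum>p\<le>m. binom_coeff \<beta> p * (real p * u ^ (p - 1))) = (\<Sum>p = 1..m. binom_coeff \<beta> p * (real p * u ^ (p - 1)))"
    by (intro sum.mono_neutral_right) auto
  finally show ?thesis .
qed

lemma has_real_derivative_binom_poly_shift: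
  "(binom_poly (\<beta> + 1) (Suc m) has_real_derivative - (\<beta> + 1) * binom_poly \<beta> m u) (at u)"
proof -
  have "(\<Sum>p = 1..Suc m. binom_coeff (\<beta> + 1) p * (real p * u ^ (p - 1)))
      = (\<Sum>p\<le>m. (real p + 1) * binom_coeff (\<beta> + 1) (Suc p) * u ^ p)"
    by (simp add: sum.atLeast1_atMost_eq lessThan_Suc_atMost algebra_simps del: sum.cl_ivl_Suc sum.lessThan_Suc)
  also have "\<dots> = - (\<beta> + 1) * binom_poly \<beta> m u"
    unfolding binom_coeff_Suc_shift binom_poly_def by (simp add: sum_distrib_left mult.assoc)
  finally show ?thesis
    using has_real_derivative_binom_poly[of "\<beta> + 1" "Suc m" u] by simp
qed

lemma continuous_on_binom_poly: "continuous_on S (binom_poly \<beta> m)"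
  unfolding binom_poly_def by (intro continuous_intros)

text \<open>On the right stands a Taylor expansion at a with a polynomial kernel, on the left the
  same quantity in terms of data at t and moments of \<open>f 0\<close>. The degree
  \<open>M + m\<close> grows with \<open>m\<close> because each integration by parts lowers exponent
  and degree together. The case \<open>m = n\<close>, \<open>M = N - n\<close> is the one
  needed.\<close>

lemma log_binom_poly_expansion:
  fixes f :: "nat \<Rightarrow> real \<Rightarrow> real" and \<alpha> l :: real
  assumes "0 < a" "a < t" "\<alpha> < 1" and l: "l = ln (t / a)"
    and f: "\<And>i \<tau>. i \<le> n \<Longrightarrow> \<tau> \<in> {a..t} \<Longrightarrow> (f i has_real_derivative f (Suc i) \<tau> / \<tau>) (at \<tau> within {a..t})"
    and c: "continuous_on {a..t} (f (Suc n))"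
    and "m \<le> n"
  shows "(\<Sum>i\<le>m. binom_poly (real i - \<alpha>) (M + i) 1 * f i t * l powr (real i - \<alpha>) / Gamma (real i + 1 - \<alpha>))
      - 1 / Gamma (1 - \<alpha>) * (\<Sum>q = 1..M. binom_coeff (- \<alpha>) q * l powr (- \<alpha> - real q)
          * integral {a..t} (\<lambda>\<tau>. real q * ln (\<tau> / a) ^ (q - 1) * (f 0 \<tau> / \<tau>)))
    = (\<Sum>i\<le>m. f i a * l powr (real i - \<alpha>) / Gamma (real i + 1 - \<alpha>))
      + l powr (real m - \<alpha>) / Gamma (real m + 1 - \<alpha>)
        * integral {a..t} (\<lambda>\<tau>. binom_poly (real m - \<alpha>) (M + m) (ln (\<tau> / a) / l) * (f (Suc m) \<tau> / \<tau>))"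
    (is "?A m - ?B = ?T m + ?P m")
  using assms(7)
proof (induction m)
  case 0
  have "l > 0" using assms by simp
  let ?S' = "\<lambda>u. \<Sum>p = 1..M. binom_coeff (- \<alpha>) p * (real p * u ^ (p - 1))"
  let ?I = "\<lambda>q. integral {a..t} (\<lambda>\<tau>. real q * ln (\<tau> / a) ^ (q - 1) * (f 0 \<tau> / \<tau>))"
  have cf: "continuous_on {a..t} (f i)" if "i \<le> Suc n" for i
    using continuous_on_deriv_chain[OF f c that] .
  \<comment> \<open>The last integration by parts, from \<open>f 1\<close> to \<open>f 0\<close>;
    the differentiated kernel is then split into monomials, whose integrals are the moments that
    become \<open>V\<close>.\<close>
  have "integral {a..t} (\<lambda>\<tau>. binom_poly (- \<alpha>) M (ln (\<tau> / a) / l) * (f 1 \<tau> / \<tau>))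
    = binom_poly (- \<alpha>) M 1 * f 0 t - binom_poly (- \<alpha>) M 0 * f 0 a
      - 1 / l * integral {a..t} (\<lambda>\<tau>. ?S' (ln (\<tau> / a) / l) * (f 0 \<tau> / \<tau>))"
    using assms(1,2) l f[of 0] cf[of 1]
    by (intro log_polynomial_by_parts has_real_derivative_binom_poly) (auto intro!: continuous_intros)
  also have "integral {a..t} (\<lambda>\<tau>. ?S' (ln (\<tau> / a) / l) * (f 0 \<tau> / \<tau>))
    = integral {a..t} (\<lambda>\<tau>. \<Sum>q = 1..M. binom_coeff (- \<alpha>) q * l powr (1 - real q)
        * (real q * ln (\<tau> / a) ^ (q - 1) * (f 0 \<tau> / \<tau>)))"
  proof (rule integral_cong)
    fix \<tau>
    \<comment> \<open>Since q \<ge> 1, the subtraction \<open>q - 1\<close> on \<open>nat\<close>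
      does not truncate.\<close>
    have "(ln (\<tau> / a) / l) ^ (q - 1) = l powr (1 - real q) * ln (\<tau> / a) ^ (q - 1)" if "q \<in> {1..M}" for q
    proof -
      have "l powr (1 - real q) = inverse (l ^ (q - 1))"
        using \<open>l > 0\<close> that powr_minus[of l "real (q - 1)"] powr_realpow[of l "q - 1"]
        by (simp add: of_nat_diff)
      then show ?thesis by (simp add: power_divide field_simps)
    qed
    then show "?S' (ln (\<tau> / a) / l) * (f 0 \<tau> / \<tau>) = (\<Sum>q = 1..M. binom_coeff (- \<alpha>) q * l powr (1 - real q)
        * (real q * ln (\<tau> / a) ^ (q - 1) * (f 0 \<tau> / \<tau>)))"
      unfolding sum_distrib_right by (intro sum.cong) auto
  qed
  also have "\<dots> = (\<Sum>q = 1..M. binom_coeff (- \<alpha>) q * l powr (1 - real q) * ?I q)"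
  proof (subst integral_sum)
    show "(\<lambda>\<tau>. binom_coeff (- \<alpha>) q * l powr (1 - real q) * (real q * ln (\<tau> / a) ^ (q - 1) * (f 0 \<tau> / \<tau>)))
        integrable_on {a..t}" for q
      using assms(1,2) cf[of 0] by (intro integrable_continuous_interval continuous_intros) auto
  qed (simp_all only: integral_mult_right finite_atLeastAtMost)
  finally have eq: "integral {a..t} (\<lambda>\<tau>. binom_poly (- \<alpha>) M (ln (\<tau> / a) / l) * (f 1 \<tau> / \<tau>))
    = binom_poly (- \<alpha>) M 1 * f 0 t - f 0 a
      - 1 / l * (\<Sum>q = 1..M. binom_coeff (- \<alpha>) q * l powr (1 - real q) * ?I q)" by simp
  have Z: "l powr (- \<alpha>) * (1 / l * (\<Sum>q = 1..M. binom_coeff (- \<alpha>) q * l powr (1 - real q) * ?I q))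
      = (\<Sum>q = 1..M. binom_coeff (- \<alpha>) q * l powr (- \<alpha> - real q) * ?I q)"
  proof -
    have "l powr (- \<alpha> - real q) = l powr (- \<alpha>) * (1 / l * l powr (1 - real q))" for q
      using \<open>l > 0\<close> by (simp add: powr_diff powr_minus field_simps)
    then show ?thesis
      by (simp add: sum_distrib_left mult_ac)
  qed
  have alg: "c * y * P / G - 1 / G * s = z * P / G + P / G * J"
    if "J = c * y - z - r" "P * r = s" for J c y z r P s G :: real
    unfolding that(1) that(2)[symmetric] by (simp add: algebra_simps diff_divide_distrib add_divide_distrib)
  show ?case
    using alg[OF eq Z, of "Gamma (1 - \<alpha>)"] by simp
next
  case (Suc m)
  have "l > 0" using assms by simp
  let ?\<beta> = "real m + 1 - \<alpha>"
  have \<beta>: "?\<beta> > 0" using assms by simp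
  have e: "real m - \<alpha> + 1 = ?\<beta>" "real (Suc m) - \<alpha> = ?\<beta>" by simp_all
  let ?J = "\<lambda>m. integral {a..t} (\<lambda>\<tau>. binom_poly (real m - \<alpha>) (M + m) (ln (\<tau> / a) / l) * (f (Suc m) \<tau> / \<tau>))"
  \<comment> \<open>Integrating by parts at level \<open>Suc m\<close> returns the integral of level
    \<open>m\<close>; the equation is afterwards solved for the latter.\<close>
  have "integral {a..t} (\<lambda>\<tau>. binom_poly (real m - \<alpha> + 1) (Suc (M + m)) (ln (\<tau> / a) / l) * (f (Suc (Suc m)) \<tau> / \<tau>))
    = binom_poly (real m - \<alpha> + 1) (Suc (M + m)) 1 * f (Suc m) t
      - binom_poly (real m - \<alpha> + 1) (Suc (M + m)) 0 * f (Suc m) a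
      - 1 / l * integral {a..t} (\<lambda>\<tau>. (- (real m - \<alpha> + 1) * binom_poly (real m - \<alpha>) (M + m) (ln (\<tau> / a) / l)) * (f (Suc m) \<tau> / \<tau>))"
    using assms(1,2) l Suc.prems continuous_on_deriv_chain[OF f c]
    by (intro log_polynomial_by_parts has_real_derivative_binom_poly_shift f)
       (auto intro!: continuous_intros continuous_on_binom_poly)
  also have "(\<lambda>\<tau>. (- (real m - \<alpha> + 1) * binom_poly (real m - \<alpha>) (M + m) (ln (\<tau> / a) / l)) * (f (Suc m) \<tau> / \<tau>))
      = (\<lambda>\<tau>. - ?\<beta> * (binom_poly (real m - \<alpha>) (M + m) (ln (\<tau> / a) / l) * (f (Suc m) \<tau> / \<tau>)))"
    by (simp only: mult.assoc diff_add_eq)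
  also have "integral {a..t} \<dots> = - ?\<beta> * ?J m"
    by (rule integral_mult_right)
  finally have J': "?J (Suc m) = binom_poly ?\<beta> (M + Suc m) 1 * f (Suc m) t - 1 * f (Suc m) a - 1 / l * (- ?\<beta> * ?J m)"
    by (simp only: e add_Suc_right binom_poly_0)
  have alg: "J = l / c * (K - p + r)" if "K = p - 1 * r - 1 / l * (- c * J)" "c > 0" "l > 0" for J K l p r c :: real
    using that by (simp add: field_simps)
  have J: "?J m = l / ?\<beta> * (?J (Suc m) - binom_poly ?\<beta> (M + Suc m) 1 * f (Suc m) t + f (Suc m) a)"
    by (rule alg[OF J' \<beta> \<open>l > 0\<close>])
  have G: "Gamma (real (Suc m) + 1 - \<alpha>) = ?\<beta> * Gamma ?\<beta>"
    using Gamma_plus1_real[OF \<beta>] by (simp add: algebra_simps)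
  have l': "l powr (real m - \<alpha>) * l = l powr (real (Suc m) - \<alpha>)"
    using \<open>l > 0\<close> by (simp add: powr_diff powr_add)
  have "?P m = l powr (real (Suc m) - \<alpha>) / Gamma (real (Suc m) + 1 - \<alpha>)
      * (?J (Suc m) - binom_poly ?\<beta> (M + Suc m) 1 * f (Suc m) t + f (Suc m) a)"
    unfolding J G l'[symmetric] by (simp add: mult_ac)
  also have "\<dots> = ?P (Suc m) - binom_poly (real (Suc m) - \<alpha>) (M + Suc m) 1 * f (Suc m) t * l powr (real (Suc m) - \<alpha>) / Gamma (real (Suc m) + 1 - \<alpha>)
      + f (Suc m) a * l powr (real (Suc m) - \<alpha>) / Gamma (real (Suc m) + 1 - \<alpha>)"
    by (simp add: algebra_simps diff_divide_distrib add_divide_distrib)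
  finally have P: "?P m = \<dots>" .
  have alg: "A + u - B = T + w + P'" if "A - B = T + P" "P = P' - u + w" for A B T P P' u w :: real
    using that by simp
  show ?case
    unfolding sum.atMost_Suc by (rule alg[OF Suc.IH[OF Suc_leD[OF Suc.prems]] P])
qed

section \<open>The truncation error\<close>

lemma of_nat_minus_fraction_notin_Ints:
  fixes \<alpha> :: real
  assumes "0 < \<alpha>" "\<alpha> < 1"
  shows "real i - \<alpha> \<notin> \<int>"
proof
  assume "real i - \<alpha> \<in> \<int>"
  then have "real i - (real i - \<alpha>) \<in> \<int>" by (intro Ints_diff) auto
  then obtain k where "\<alpha> = of_int k" by (auto elim: Ints_cases)
  with assms show False by auto
qed

text \<open>With p = k + (n - i) the Gamma quotient becomes \<Gamma>(k - \<beta>) / (\<Gamma>(-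
  \<beta>) k!) for \<beta> = i - \<alpha>, which is not an integer.\<close>

lemma A_summand_eq_binom_coeff:
  assumes "0 < \<alpha>" "\<alpha> < 1" "i \<le> n"
  shows "A_summand \<alpha> n i (k + (n - i)) = binom_coeff (real i - \<alpha>) k"
proof -
  have *: "real (k + (n - i)) + \<alpha> - real n = real k - (real i - \<alpha>)" "k + (n - i) + i - n = k"
    using assms by (auto simp: of_nat_diff)
  then show ?thesis
    unfolding A_summand_def * binom_coeff_Gamma[OF of_nat_minus_fraction_notin_Ints[OF assms(1,2)]]
    by simp
qed

text \<open>The leading 1 in the bracket is the coefficient with index 0, so the bracket is a full
  partial sum at u = 1.\<close>

lemma A_coeff_trunc_eq_binom_poly:
  assumes "0 < \<alpha>" "\<alpha> < 1" "i \<le> n" "n \<le> N"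
  shows "A_coeff_trunc \<alpha> n N i = binom_poly (real i - \<alpha>) (N - n + i) 1 / Gamma (real i + 1 - \<alpha>)"
proof -
  have "(\<Sum>p = n - i + 1..N. A_summand \<alpha> n i p) = (\<Sum>p = 1 + (n - i)..(N - n + i) + (n - i). A_summand \<alpha> n i p)"
    using assms by (intro sum.cong) auto
  also have "\<dots> = (\<Sum>k = 1..N - n + i. binom_coeff (real i - \<alpha>) k)"
    unfolding sum.shift_bounds_cl_nat_ivl by (simp only: A_summand_eq_binom_coeff[OF assms(1-3)])
  also have "1 + \<dots> = binom_poly (real i - \<alpha>) (N - n + i) 1"
  proof -
    have "{..N - n + i} = insert 0 {1..N - n + i}" by auto
    then show ?thesis by (simp add: binom_poly_def)
  qed
  finally show ?thesis
    by (simp add: A_coeff_trunc_def)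
qed

text \<open>For i \<ge> 1 the exponent i - \<alpha> is positive, which makes the coefficients
  summable. At i = 0 it is - \<alpha>, so that sum is not taken to the limit separately but stays
  paired with the \<open>V\<close> terms.\<close>

lemma A_coeff_trunc_tendsto:
  assumes "0 < \<alpha>" "\<alpha> < 1" "1 \<le> i" "i \<le> n"
  shows "summable (\<lambda>k. A_summand \<alpha> n i (n - i + 1 + k))"
    and "(\<lambda>K. A_coeff_trunc \<alpha> n (n + K) i) \<longlonglongrightarrow> A_coeff \<alpha> n i"
proof -
  have eq: "A_summand \<alpha> n i (n - i + 1 + k) = binom_coeff (real i - \<alpha>) (Suc k)" for k
  proof -
    have "n - i + 1 + k = Suc k + (n - i)" by simp
    then show ?thesis by (simp only: A_summand_eq_binom_coeff[OF assms(1,2,4)])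
  qed
  have "summable (binom_coeff (real i - \<alpha>))"
    using assms by (intro summable_rabs_cancel[OF summable_abs_binom_coeff]) simp
  then show s: "summable (\<lambda>k. A_summand \<alpha> n i (n - i + 1 + k))"
    unfolding eq by (subst summable_Suc_iff)
  have "(\<Sum>p = n - i + 1..n + K. A_summand \<alpha> n i p) = (\<Sum>k<K + i. A_summand \<alpha> n i (n - i + 1 + k))" for K
  proof -
    \<comment> \<open>The range has K + i elements because i \<le> n.\<close>
    have "{n - i + 1..n + K} = {n - i + 1..<n - i + 1 + (K + i)}"
      using assms by auto
    then show ?thesis
      by (simp only: sum.atLeastLessThan_shift_0[of _ "n - i + 1"] lessThan_atLeast0 add_diff_cancel_left' comp_def)
  qed
  then have trunc: "(\<lambda>K. A_coeff_trunc \<alpha> n (n + K) i)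
      = (\<lambda>K. 1 / Gamma (real i + 1 - \<alpha>) * (1 + (\<Sum>k<K + i. A_summand \<alpha> n i (n - i + 1 + k))))"
    by (simp only: A_coeff_trunc_def)
  have lim: "(\<lambda>K. \<Sum>k<K + i. A_summand \<alpha> n i (n - i + 1 + k)) \<longlonglongrightarrow> (\<Sum>k. A_summand \<alpha> n i (n - i + 1 + k))"
    by (rule LIMSEQ_ignore_initial_segment[OF summable_LIMSEQ[OF s]])
  show "(\<lambda>K. A_coeff_trunc \<alpha> n (n + K) i) \<longlonglongrightarrow> A_coeff \<alpha> n i"
    unfolding A_coeff_def trunc by (rule tendsto_mult[OF tendsto_const tendsto_add[OF tendsto_const lim]])
qed

text \<open>\<Gamma>(1 - \<alpha>) = - \<alpha> \<Gamma>(- \<alpha>) and \<Gamma>(1 + \<alpha>) =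
  \<alpha> \<Gamma>(\<alpha>) give \<Gamma>(- \<alpha>) \<Gamma>(1 + \<alpha>) = - \<Gamma>(1 -
  \<alpha>) \<Gamma>(\<alpha>).\<close>

lemma B_coeff_eq_binom_coeff:
  assumes "0 < \<alpha>" "\<alpha> < 1"
  shows "B_coeff \<alpha> n (q + n) = - binom_coeff (- \<alpha>) q / Gamma (1 - \<alpha>)"
proof -
  have "Gamma (- \<alpha> + 1) = - \<alpha> * Gamma (- \<alpha>)"
    using of_nat_minus_fraction_notin_Ints[OF assms, of 0] nonpos_Ints_Int by (intro Gamma_plus1) auto
  moreover have "Gamma (\<alpha> + 1) = \<alpha> * Gamma \<alpha>"
    using assms by (intro Gamma_plus1_real)
  ultimately have "Gamma (- \<alpha>) * Gamma (1 + \<alpha>) = - (Gamma (1 - \<alpha>) * Gamma \<alpha>)"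
    by (simp add: add.commute)
  moreover have "- \<alpha> \<notin> \<int>"
    using of_nat_minus_fraction_notin_Ints[OF assms, of 0] by simp
  ultimately show ?thesis
    unfolding B_coeff_def binom_coeff_Gamma[OF \<open>- \<alpha> \<notin> \<int>\<close>] by (simp add: mult_ac)
qed

text \<open>The approximation is exactly the Taylor formula with its kernel replaced by the binomial
  partial sum of degree \<open>N\<close>; the sum over p becomes the moment sum under q = p -
  n.\<close>

lemma hadamard_approx_eq:
  fixes \<alpha> l :: real
  assumes "0 < \<alpha>" "\<alpha> < 1" "0 < a" "a < t" "t < b" "C_Icc (n + 1) a b x" "n \<le> N" and l: "l = ln (t / a)"
  shows "hadamard_approx a b \<alpha> x n N t =
    (\<Sum>i\<le>n. x0 a b x i a * l powr (real i - \<alpha>) / Gamma (real i + 1 - \<alpha>))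
      + l powr (real n - \<alpha>) / Gamma (real n + 1 - \<alpha>)
        * integral {a..t} (\<lambda>\<tau>. binom_poly (real n - \<alpha>) N (ln (\<tau> / a) / l) * (x0 a b x (Suc n) \<tau> / \<tau>))"
proof -
  have f: "(x0 a b x i has_real_derivative x0 a b x (Suc i) \<tau> / \<tau>) (at \<tau> within {a..t})"
    if "i \<le> n" "\<tau> \<in> {a..t}" for i \<tau>
    using has_real_derivative_restrict_Icc[OF _ has_real_derivative_x0[OF assms(3) _ assms(6) that(1)] that(2)] assms
    by auto
  have "C_Icc 0 a b (x0 a b x (Suc n))"
    using assms by (intro C_Icc_x0) auto
  then have c: "continuous_on {a..t} (x0 a b x (Suc n))"
    using assms by (auto intro: continuous_on_subset)
  have "(\<Sum>i = 0..n. A_coeff_trunc \<alpha> n N i * l powr (real i - \<alpha>) * x0 a b x i t)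
      = (\<Sum>i\<le>n. binom_poly (real i - \<alpha>) (N - n + i) 1 * x0 a b x i t * l powr (real i - \<alpha>) / Gamma (real i + 1 - \<alpha>))"
    unfolding atLeast0AtMost using assms by (intro sum.cong) (auto simp: A_coeff_trunc_eq_binom_poly)
  moreover have "(\<Sum>p = n + 1..N. B_coeff \<alpha> n p * l powr (real n - \<alpha> - real p) * V a x n p t)
      = - (1 / Gamma (1 - \<alpha>) * (\<Sum>q = 1..N - n. binom_coeff (- \<alpha>) q * l powr (- \<alpha> - real q)
          * integral {a..t} (\<lambda>\<tau>. real q * ln (\<tau> / a) ^ (q - 1) * (x \<tau> / \<tau>))))"
  proof -
    have "(\<Sum>p = n + 1..N. B_coeff \<alpha> n p * l powr (real n - \<alpha> - real p) * V a x n p t)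
      = (\<Sum>p = 1 + n..(N - n) + n. B_coeff \<alpha> n p * l powr (real n - \<alpha> - real p) * V a x n p t)"
      using assms by simp
    also have "\<dots> = (\<Sum>q = 1..N - n. - (1 / Gamma (1 - \<alpha>) * (binom_coeff (- \<alpha>) q * l powr (- \<alpha> - real q)
          * integral {a..t} (\<lambda>\<tau>. real q * ln (\<tau> / a) ^ (q - 1) * (x \<tau> / \<tau>)))))"
      unfolding sum.shift_bounds_cl_nat_ivl
      by (intro sum.cong) (simp_all add: B_coeff_eq_binom_coeff assms V_def mult_ac)
    finally show ?thesis
      by (simp only: sum_negf sum_distrib_left)
  qed
  ultimately show ?thesis
    using log_binom_poly_expansion[OF assms(3,4,2) l f c order_refl, of "N - n"] assms(7)
    unfolding hadamard_approx_def l by simp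
qed

text \<open>Differentiability is recorded separately, so that the \<open>deriv\<close> inside
  \<open>hadamard_deriv\<close> is a genuine derivative.\<close>

lemma hadamard_integral_taylor:
  assumes "0 < \<alpha>" "\<alpha> < 1" "1 \<le> n" "0 < a" "a < t" "t < b" "C_Icc (n + 1) a b x"
  shows "hadamard_integral a \<alpha> x differentiable (at t)"
    and "hadamard_deriv a \<alpha> x t =
      (\<Sum>i\<le>n. x0 a b x i a * ln (t / a) powr (real i - \<alpha>) / Gamma (real i + 1 - \<alpha>))
      + 1 / Gamma (real n + 1 - \<alpha>)
        * integral {a..t} (\<lambda>\<tau>. ln (t / \<tau>) powr (real n - \<alpha>) * (x0 a b x (Suc n) \<tau> / \<tau>))"
proof -
  have "C_Icc 0 a b (x0 a b x (Suc n))"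
    using assms by (intro C_Icc_x0) auto
  then have c: "continuous_on {a..b} (x0 a b x (Suc n))" by (simp only: C_Icc.simps)
  have "a < b" using assms by simp
  then have f: "(x0 a b x i has_real_derivative x0 a b x (Suc i) \<tau> / \<tau>) (at \<tau> within {a..b})"
    if "i \<le> n" "\<tau> \<in> {a..b}" for i \<tau>
    using has_real_derivative_x0[OF assms(4) _ assms(7) that] by blast
  have *: "(hadamard_integral a \<alpha> (x0 a b x 0) has_real_derivative
    ((\<Sum>i\<le>n. x0 a b x i a * ln (t / a) powr (real i - \<alpha>) / Gamma (real i + 1 - \<alpha>))
      + 1 / Gamma (real n + 1 - \<alpha>)
        * integral {a..t} (\<lambda>\<tau>. ln (t / \<tau>) powr (real n - \<alpha>) * (x0 a b x (Suc n) \<tau> / \<tau>))) / t) (at t)"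
    by (rule hadamard_integral_has_real_derivative[OF assms(4-6,1-3) f c])
  then show "hadamard_integral a \<alpha> x differentiable (at t)"
    unfolding x0.simps(1) real_differentiable_def by blast
  show "hadamard_deriv a \<alpha> x t =
      (\<Sum>i\<le>n. x0 a b x i a * ln (t / a) powr (real i - \<alpha>) / Gamma (real i + 1 - \<alpha>))
      + 1 / Gamma (real n + 1 - \<alpha>)
        * integral {a..t} (\<lambda>\<tau>. ln (t / \<tau>) powr (real n - \<alpha>) * (x0 a b x (Suc n) \<tau> / \<tau>))"
    using DERIV_imp_deriv[OF *] assms by (simp add: hadamard_deriv_def)
qed

section \<open>Integral form and bound of the error\<close>

text \<open>The derivative and the approximation share the same Taylor sum at a. It cancels, leaving
  the difference of the two kernels, which is the binomial remainder \<open>R\<close>.\<close>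

lemma E_tr_eq:
  fixes \<alpha> l :: real
  assumes "0 < \<alpha>" "\<alpha> < 1" "1 \<le> n" "0 < a" "a < t" "t < b" "C_Icc (n + 1) a b x" "n \<le> N"
    and l: "l = ln (t / a)"
  defines "R \<equiv> \<lambda>u. (1 - u) powr (real n - \<alpha>) - binom_poly (real n - \<alpha>) N u"
  shows "((\<lambda>\<tau>. R (ln (\<tau> / a) / l) * x1 a b x n \<tau>) has_integral
    E_tr a b \<alpha> x n N t * Gamma (real n + 1 - \<alpha>) / l powr (real n - \<alpha>)) {a..t}"
proof -
  have "l > 0" using assms by simp
  define g where "g = (\<lambda>\<tau>. x0 a b x (Suc n) \<tau> / \<tau>)"
  have "C_Icc 0 a b (x0 a b x (Suc n))"
    using assms by (intro C_Icc_x0) auto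
  then have cg: "continuous_on {a..t} g"
    unfolding g_def using assms by (intro continuous_intros) (auto intro: continuous_on_subset)
  have cv: "continuous_on {a..t} (\<lambda>\<tau>. ln (\<tau> / a) / l)"
    using assms(4,5) \<open>l > 0\<close> by (intro continuous_intros) auto
  have i1: "(\<lambda>\<tau>. ln (t / \<tau>) powr (real n - \<alpha>) * g \<tau>) integrable_on {a..t}"
    using assms(1-5) by (intro integrable_continuous_interval continuous_on_mult continuous_on_ln_powr cg) auto
  have i2: "(\<lambda>\<tau>. binom_poly (real n - \<alpha>) N (ln (\<tau> / a) / l) * g \<tau>) integrable_on {a..t}"
    by (intro integrable_continuous_interval continuous_on_mult cg
          continuous_on_compose2[OF continuous_on_binom_poly cv]) auto
  have "((\<lambda>\<tau>. (1 / l powr (real n - \<alpha>)) * (ln (t / \<tau>) powr (real n - \<alpha>) * g \<tau>)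
      - binom_poly (real n - \<alpha>) N (ln (\<tau> / a) / l) * g \<tau>) has_integral
    (1 / l powr (real n - \<alpha>)) * integral {a..t} (\<lambda>\<tau>. ln (t / \<tau>) powr (real n - \<alpha>) * g \<tau>)
      - integral {a..t} (\<lambda>\<tau>. binom_poly (real n - \<alpha>) N (ln (\<tau> / a) / l) * g \<tau>)) {a..t}"
    by (intro has_integral_diff has_integral_mult_right integrable_integral i1 i2)
  also have "(1 / l powr (real n - \<alpha>)) * integral {a..t} (\<lambda>\<tau>. ln (t / \<tau>) powr (real n - \<alpha>) * g \<tau>)
      - integral {a..t} (\<lambda>\<tau>. binom_poly (real n - \<alpha>) N (ln (\<tau> / a) / l) * g \<tau>)
    = E_tr a b \<alpha> x n N t * Gamma (real n + 1 - \<alpha>) / l powr (real n - \<alpha>)"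
  proof -
    have G: "Gamma (real n + 1 - \<alpha>) > 0" using assms by (intro Gamma_real_pos) simp
    have alg: "1 / P * u - v = (T + 1 / G * u - (T + P / G * v)) * G / P"
      if "G > 0" "P > 0" for G P T u v :: real
      using that by (simp add: field_simps)
    show ?thesis
      unfolding E_tr_def hadamard_approx_eq[OF assms(1,2,4-9)]
        hadamard_integral_taylor(2)[OF assms(1-7)] g_def l[symmetric]
      by (rule alg[OF G]) (use \<open>l > 0\<close> in simp)
  qed
  finally show ?thesis
  proof (rule has_integral_eq[rotated])
    fix \<tau> assume \<tau>: "\<tau> \<in> {a..t}"
    have "l * (1 - ln (\<tau> / a) / l) = l - ln (\<tau> / a)"
      using \<open>l > 0\<close> by (simp add: right_diff_distrib)
    then have "ln (t / \<tau>) = l * (1 - ln (\<tau> / a) / l)"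
      using \<tau> assms(4,5) l by (simp add: ln_div)
    \<comment> \<open>Needed to split the real power of the product l (1 - u).\<close>
    moreover have "0 \<le> 1 - ln (\<tau> / a) / l"
      using \<tau> \<open>l > 0\<close> assms by (simp add: ln_div)
    ultimately have "ln (t / \<tau>) powr (real n - \<alpha>) = l powr (real n - \<alpha>) * (1 - ln (\<tau> / a) / l) powr (real n - \<alpha>)"
      using \<open>l > 0\<close> by (simp add: powr_mult)
    moreover have "x1 a b x n \<tau> = g \<tau>"
      using x1_eq[OF assms(4) _ assms(7) order_refl] \<tau> assms by (auto simp: g_def)
    ultimately show "(1 / l powr (real n - \<alpha>)) * (ln (t / \<tau>) powr (real n - \<alpha>) * g \<tau>)
      - binom_poly (real n - \<alpha>) N (ln (\<tau> / a) / l) * g \<tau> = R (ln (\<tau> / a) / l) * x1 a b x n \<tau>"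
      using \<open>l > 0\<close> by (simp add: R_def algebra_simps)
  qed
qed

text \<open>\<open>GREATEST\<close> is meaningful only if the maximum is attained; compactness and
  the continuity of \<open>x0 a b x (Suc n) \<tau> / \<tau>\<close> provide this.\<close>

lemma abs_x1_le_L:
  assumes "0 < a" "a < t" "t \<le> b" "C_Icc (n + 1) a b x" "\<tau> \<in> {a..t}"
  shows "\<bar>x1 a b x n \<tau>\<bar> \<le> L a b x n t"
proof -
  have "C_Icc 0 a b (x0 a b x (Suc n))"
    using assms by (intro C_Icc_x0) auto
  then have c: "continuous_on {a..t} (\<lambda>\<tau>. \<bar>x0 a b x (Suc n) \<tau> / \<tau>\<bar>)"
    using assms by (intro continuous_intros) (auto intro: continuous_on_subset)
  have "{a..t} \<noteq> {}" using assms(2) by simp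
  from continuous_attains_sup[OF compact_Icc this c] obtain m where m: "m \<in> {a..t}"
    and le: "\<forall>y\<in>{a..t}. \<bar>x0 a b x (Suc n) y / y\<bar> \<le> \<bar>x0 a b x (Suc n) m / m\<bar>"
    by (elim bexE)
  have eq: "x1 a b x n y = x0 a b x (Suc n) y / y" if "y \<in> {a..t}" for y
    using x1_eq[OF assms(1) _ assms(4) order_refl, of y] that assms(2,3) by simp
  have max: "\<bar>x1 a b x n y\<bar> \<le> \<bar>x1 a b x n m\<bar>" if "y \<in> {a..t}" for y
    using bspec[OF le that] unfolding eq[OF that] eq[OF m] .
  have "L a b x n t = \<bar>x1 a b x n m\<bar>"
    unfolding L_def
  proof (rule Greatest_equality)
    show "\<bar>x1 a b x n m\<bar> \<in> (\<lambda>\<tau>. \<bar>x1 a b x n \<tau>\<bar>) ` {a..t}"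
      using m by (rule imageI)
    show "y \<le> \<bar>x1 a b x n m\<bar>" if "y \<in> (\<lambda>\<tau>. \<bar>x1 a b x n \<tau>\<bar>) ` {a..t}" for y
      using that by (elim imageE) (simp only: max)
  qed
  then show ?thesis using max[OF assms(5)] by simp
qed

lemma abs_E_tr_le:
  assumes "0 < \<alpha>" "\<alpha> < 1" "1 \<le> n" "0 < a" "a < t" "t < b" "C_Icc (n + 1) a b x" "n \<le> N"
  shows "\<bar>E_tr a b \<alpha> x n N t\<bar> \<le> L a b x n t
    * (exp ((real n - \<alpha>)\<^sup>2 + real n - \<alpha>)
       / (Gamma (real n + 1 - \<alpha>) * (real n - \<alpha>) * real N powr (real n - \<alpha>)))
    * ln (t / a) powr (real n - \<alpha>) * (t - a)"
proof -
  define l where "l = ln (t / a)"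
  define \<beta> where "\<beta> = real n - \<alpha>"
  define C where "C = exp (\<beta>\<^sup>2 + \<beta>) / (\<beta> * real N powr \<beta>)"
  have pos: "l > 0" "\<beta> > 0" "Gamma (real n + 1 - \<alpha>) > 0"
    using assms by (auto simp: l_def \<beta>_def intro!: Gamma_real_pos)
  have "C \<ge> 0" using pos by (simp add: C_def)
  have L: "L a b x n t \<ge> 0"
    using order_trans[OF abs_ge_zero abs_x1_le_L[of a t b n x t]] assms by simp
  have "norm (E_tr a b \<alpha> x n N t * Gamma (real n + 1 - \<alpha>) / l powr \<beta>) \<le> C * L a b x n t * measure lborel {a..t}"
    unfolding \<beta>_def
  \<comment> \<open>The point \<tau> = t, where u = 1, is excepted because the remainder bound is
    available only for u < 1.\<close>
  proof (rule has_integral_bound_real[OF _ _ E_tr_eq[OF assms l_def], where S = "{t}"])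
    fix \<tau> assume \<tau>: "\<tau> \<in> {a..t} - {t}"
    have "\<tau> / a < t / a" "1 \<le> \<tau> / a"
      using \<tau> assms(4) by (auto intro: divide_strict_right_mono)
    then have "ln (\<tau> / a) < l" "0 \<le> ln (\<tau> / a)"
      unfolding l_def by (auto intro: ln_ge_zero)
    then have "0 \<le> ln (\<tau> / a) / l" "ln (\<tau> / a) / l < 1"
      using pos(1) by auto
    then have R: "\<bar>(1 - ln (\<tau> / a) / l) powr \<beta> - binom_poly \<beta> N (ln (\<tau> / a) / l)\<bar> \<le> C"
      unfolding C_def binom_poly_def using pos assms(3,8) by (intro binom_remainder_bound) auto
    have "\<bar>x1 a b x n \<tau>\<bar> \<le> L a b x n t"
      using \<tau> assms by (intro abs_x1_le_L) auto
    with R show "norm (((1 - ln (\<tau> / a) / l) powr (real n - \<alpha>) - binom_poly (real n - \<alpha>) N (ln (\<tau> / a) / l))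
        * x1 a b x n \<tau>) \<le> C * L a b x n t"
      unfolding real_norm_def abs_mult \<beta>_def[symmetric] using \<open>C \<ge> 0\<close> by (intro mult_mono) auto
  qed (use \<open>C \<ge> 0\<close> L in auto)
  then have "\<bar>E_tr a b \<alpha> x n N t\<bar> * Gamma (real n + 1 - \<alpha>) / l powr \<beta> \<le> C * L a b x n t * (t - a)"
    using pos assms by (simp add: abs_mult)
  then have "\<bar>E_tr a b \<alpha> x n N t\<bar> \<le> C * L a b x n t * (t - a) * l powr \<beta> / Gamma (real n + 1 - \<alpha>)"
    using pos by (simp add: field_simps)
  also have "\<dots> = L a b x n t
    * (exp ((real n - \<alpha>)\<^sup>2 + real n - \<alpha>)
       / (Gamma (real n + 1 - \<alpha>) * (real n - \<alpha>) * real N powr (real n - \<alpha>)))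
    * ln (t / a) powr (real n - \<alpha>) * (t - a)"
    by (simp add: C_def l_def \<beta>_def mult_ac add_diff_eq)
  finally show ?thesis .
qed

section \<open>Passage to the limit\<close>

text \<open>The summand with i = 0 is broken up: its leading 1 gives the first term, and the rest,
  which ranges over the same p as the \<open>V\<close> terms, is distributed among them to form
  \<open>series_term\<close>.\<close>

lemma hadamard_approx_split:
  fixes \<alpha> l :: real
  assumes l: "l = ln (t / a)"
  shows "hadamard_approx a b \<alpha> x n (n + K) t = 1 / Gamma (1 - \<alpha>) * l powr (- \<alpha>) * x t
    + (\<Sum>i = 1..n. A_coeff_trunc \<alpha> n (n + K) i * l powr (real i - \<alpha>) * x0 a b x i t)
    + (\<Sum>k<K. series_term a \<alpha> x n t (n + 1 + k))"
proof -
  have r: "(\<Sum>p = n + 1..n + K. h p) = (\<Sum>k<K. h (n + 1 + k))" for h :: "nat \<Rightarrow> real"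
    by (intro sum.reindex_bij_witness[of _ "\<lambda>k. n + 1 + k" "\<lambda>p. p - (n + 1)"]) auto
  have "A_coeff_trunc \<alpha> n (n + K) 0 * l powr (real 0 - \<alpha>) * x0 a b x 0 t
    = 1 / Gamma (1 - \<alpha>) * l powr (- \<alpha>) * x t
      + (\<Sum>p = n + 1..n + K. Gamma (real p + \<alpha> - real n) / (Gamma (1 - \<alpha>) * Gamma \<alpha> * fact (p - n)) * l powr (- \<alpha>) * x t)"
    by (simp add: A_coeff_trunc_def A_summand_def distrib_left distrib_right sum_distrib_left sum_distrib_right mult_ac)
  moreover have "(\<Sum>k<K. series_term a \<alpha> x n t (n + 1 + k))
    = (\<Sum>p = n + 1..n + K. B_coeff \<alpha> n p * l powr (real n - \<alpha> - real p) * V a x n p t)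
      + (\<Sum>p = n + 1..n + K. Gamma (real p + \<alpha> - real n) / (Gamma (1 - \<alpha>) * Gamma \<alpha> * fact (p - n)) * l powr (- \<alpha>) * x t)"
    unfolding r[of "series_term a \<alpha> x n t", symmetric] unfolding series_term_def l[symmetric] sum.distrib ..
  moreover have "(\<Sum>i = 0..n. h i) = h 0 + (\<Sum>i = 1..n. h i)" for h :: "nat \<Rightarrow> real"
    by (simp add: sum.atLeast_Suc_atMost)
  ultimately show ?thesis
    unfolding hadamard_approx_def l[symmetric] by (simp only: add_ac)
qed

theorem mainTheorem4:
  fixes \<alpha> a b :: real and n :: nat and x :: "real \<Rightarrow> real"
  assumes "0 < \<alpha>" "\<alpha> < 1" "1 \<le> n" "0 < a" "a < b"
    and "C_Icc (n + 1) a b x"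
  shows "(\<forall>i\<in>{1..n}. summable (\<lambda>k. A_summand \<alpha> n i (n - i + 1 + k))) \<and>
    (\<forall>t\<in>{a<..<b}.
      hadamard_integral a \<alpha> x differentiable (at t) \<and>
      summable (\<lambda>k. series_term a \<alpha> x n t (n + 1 + k)) \<and>
      hadamard_deriv a \<alpha> x t =
        1 / Gamma (1 - \<alpha>) * ln (t / a) powr (- \<alpha>) * x t
        + (\<Sum>i = 1..n. A_coeff \<alpha> n i * ln (t / a) powr (real i - \<alpha>) * x0 a b x i t)
        + (\<Sum>k. series_term a \<alpha> x n t (n + 1 + k))) \<and>
    (\<forall>N\<ge>n + 1. \<forall>t\<in>{a<..<b}.
      \<bar>E_tr a b \<alpha> x n N t\<bar> \<le>
        L a b x n t
        * (exp ((real n - \<alpha>)^2 + real n - \<alpha>)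
           / (Gamma (real n + 1 - \<alpha>) * (real n - \<alpha>) * real N powr (real n - \<alpha>)))
        * ln (t / a) powr (real n - \<alpha>) * (t - a))"
proof (intro conjI ballI allI impI)
  note \<alpha> = assms(1,2)
  show "summable (\<lambda>k. A_summand \<alpha> n i (n - i + 1 + k))" if "i \<in> {1..n}" for i
    using A_coeff_trunc_tendsto(1)[OF \<alpha>] that by auto
  fix t assume "t \<in> {a<..<b}"
  then have t: "a < t" "t < b" by auto
  note hyps = assms(1-4) t assms(6)
  show "hadamard_integral a \<alpha> x differentiable (at t)"
    using hadamard_integral_taylor(1)[OF hyps] .
  show "\<bar>E_tr a b \<alpha> x n N t\<bar> \<le> L a b x n t
      * (exp ((real n - \<alpha>)^2 + real n - \<alpha>)
         / (Gamma (real n + 1 - \<alpha>) * (real n - \<alpha>) * real N powr (real n - \<alpha>)))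
      * ln (t / a) powr (real n - \<alpha>) * (t - a)" if "N \<ge> n + 1" for N
    using abs_E_tr_le[OF hyps] that by simp
  let ?c = "1 / Gamma (1 - \<alpha>) * ln (t / a) powr (- \<alpha>) * x t"
  let ?A = "\<Sum>i = 1..n. A_coeff \<alpha> n i * ln (t / a) powr (real i - \<alpha>) * x0 a b x i t"
  \<comment> \<open>Apart from the power N^(-(n - \<alpha>)) the error bound does not depend on N,
    and n - \<alpha> > 0.\<close>
  have "(\<lambda>K. E_tr a b \<alpha> x n (n + K) t) \<longlonglongrightarrow> 0"
  proof (rule Lim_null_comparison)
    let ?D = "L a b x n t * (exp ((real n - \<alpha>)^2 + real n - \<alpha>) / (Gamma (real n + 1 - \<alpha>) * (real n - \<alpha>)))
      * ln (t / a) powr (real n - \<alpha>) * (t - a)"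
    show "\<forall>\<^sub>F K in sequentially. norm (E_tr a b \<alpha> x n (n + K) t) \<le> ?D * real (n + K) powr (- (real n - \<alpha>))"
      using abs_E_tr_le[OF hyps le_add1] unfolding powr_minus_divide
      by (intro always_eventually allI) (simp add: mult_ac)
    have "(\<lambda>N. real N powr (- (real n - \<alpha>))) \<longlonglongrightarrow> 0"
      using assms by (intro tendsto_neg_powr filterlim_real_sequentially) auto
    from LIMSEQ_ignore_initial_segment[OF this, of n]
    show "(\<lambda>K. ?D * real (n + K) powr (- (real n - \<alpha>))) \<longlonglongrightarrow> 0"
      by (intro tendsto_mult_right_zero) (simp add: add.commute)
  qed
  moreover have "(\<lambda>K. \<Sum>i = 1..n. A_coeff_trunc \<alpha> n (n + K) i * ln (t / a) powr (real i - \<alpha>) * x0 a b x i t) \<longlonglongrightarrow> ?A"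
    using A_coeff_trunc_tendsto(2)[OF \<alpha>] by (intro tendsto_sum tendsto_mult tendsto_const) auto
  ultimately have "(\<lambda>K. hadamard_deriv a \<alpha> x t - E_tr a b \<alpha> x n (n + K) t - ?c
      - (\<Sum>i = 1..n. A_coeff_trunc \<alpha> n (n + K) i * ln (t / a) powr (real i - \<alpha>) * x0 a b x i t))
    \<longlonglongrightarrow> hadamard_deriv a \<alpha> x t - 0 - ?c - ?A"
    by (intro tendsto_diff tendsto_const)
  \<comment> \<open>The derivative minus the error is the approximation, so what is left is a
    partial sum of the series. Its convergence and its value thus follow together.\<close>
  moreover have "hadamard_deriv a \<alpha> x t - E_tr a b \<alpha> x n (n + K) t - ?c
      - (\<Sum>i = 1..n. A_coeff_trunc \<alpha> n (n + K) i * ln (t / a) powr (real i - \<alpha>) * x0 a b x i t)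
    = (\<Sum>k<K. series_term a \<alpha> x n t (n + 1 + k))" for K
    unfolding E_tr_def hadamard_approx_split[OF refl] by simp
  ultimately have *: "(\<lambda>k. series_term a \<alpha> x n t (n + 1 + k)) sums (hadamard_deriv a \<alpha> x t - ?c - ?A)"
    by (simp only: sums_def diff_0_right)
  then show "summable (\<lambda>k. series_term a \<alpha> x n t (n + 1 + k))"
    by (rule sums_summable)
  show "hadamard_deriv a \<alpha> x t = ?c + ?A + (\<Sum>k. series_term a \<alpha> x n t (n + 1 + k))"
    using sums_unique[OF *] by simp
qed

end
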